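(* Let $\mathbb A=(A_1,\dots,A_n)$ be a tuple of $N\times N$ normal complex matrices, at least one of which is nonzero. Then the following conditions are equivalent: (a) The matrices in $\mathbb A$ pairwise commute, i.e. $A_iA_j=A_jA_i$ for all $1\le i,j\le n$. (b) $\sigma_p(\mathbb A)$ is the union of finitely many complex hyperplanes in $\mathbb C^n$. (c) The complex polynomial $$p(z_1,\dots,z_n)=\det(I+z_1A_1+\cdots+z_nA_n)$$ is completely reducible.
   Context: For an $n$-tuple $\mathbb A=(A_1,\dots,A_n)$ of $N\times N$ complex matrices, the joint point spectrum is $$\sigma_p(\mathbb A)=\{(z_1,\dots,z_n)\in\mathbb C^n:\ker(I+z_1A_1+\cdots+z_nA_n)\neq(0)\}.$$ A complex hyperplane in $\mathbb C^n$ is an affine complex subspace of codimension one. A polynomial in $\mathbb C[z_1,\dots,z_n]$ is completely reducible if it can be factored into a product of linear polynomials, i.e. polynomials of degree at most one; for the polynomial $p$ above this means $p(z_1,\dots,z_n)=\prod_{k=1}^N(1+a_{k1}z_1+\cdots+a_{kn}z_n)$ for some complex numbers $a_{kj}$. A matrix $A$ is normal if $AA^*=A^*A$. *)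

theory Defs
  imports "HOL-Analysis.Analysis" "HOL-Library.Poly_Mapping"
begin

definition conj_transpose :: "complex^'m^'n \<Rightarrow> complex^'n^'m"
  where "conj_transpose A = (\<chi> i j. cnj (A $ j $ i))"

definition normal_matrix :: "complex^'n^'n \<Rightarrow> bool"
  where "normal_matrix A \<longleftrightarrow> A ** conj_transpose A = conj_transpose A ** A"

(* The coefficient ring is left general: the pencil is used both with numbers z k
   and with the indeterminates of a polynomial ring. *)
definition linear_pencil :: "('n::finite \<Rightarrow> 'a::comm_ring_1) \<Rightarrow> ('n \<Rightarrow> 'a^'m^'m) \<Rightarrow> 'a^'m^'m"
  where "linear_pencil z A = mat 1 + (\<Sum>k\<in>UNIV. \<chi> i j. z k * A k $ i $ j)"

definition joint_point_spectrum :: "('n::finite \<Rightarrow> complex^'m^'m) \<Rightarrow> (complex^'n) set"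
  where "joint_point_spectrum A =
    {z. {v. linear_pencil (\<lambda>k. z $ k) A *v v = 0} \<noteq> {0}}"

(* vec.subspace and vec.dim refer to the vector space structure over the complex numbers,
   unlike the real notions subspace and dim. *)
definition complex_hyperplane :: "(complex^'n) set \<Rightarrow> bool"
  where "complex_hyperplane H \<longleftrightarrow>
    (\<exists>a V. vec.subspace V \<and> vec.dim V + 1 = CARD('n) \<and> H = (\<lambda>v. a + v) ` V)"

(* Polynomials in indeterminates indexed by 'n: a monomial is its exponent function,
   and a polynomial maps monomials to coefficients. *)
type_synonym ('n, 'a) multipoly = "('n \<Rightarrow>\<^sub>0 nat) \<Rightarrow>\<^sub>0 'a"

definition poly_const :: "'a::zero \<Rightarrow> ('n, 'a) multipoly"
  where "poly_const c = Poly_Mapping.single 0 c"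

definition poly_var :: "'n \<Rightarrow> ('n, 'a::zero_neq_one) multipoly"
  where "poly_var k = Poly_Mapping.single (Poly_Mapping.single k 1) 1"

definition degree_at_most_one :: "('n::finite, 'a::zero) multipoly \<Rightarrow> bool"
  where "degree_at_most_one q \<longleftrightarrow>
    (\<forall>m\<in>Poly_Mapping.keys q. (\<Sum>k\<in>UNIV. Poly_Mapping.lookup m k) \<le> 1)"

definition completely_reducible :: "('n::finite, 'a::comm_ring_1) multipoly \<Rightarrow> bool"
  where "completely_reducible p \<longleftrightarrow>
    (\<exists>qs. (\<forall>q\<in>set qs. degree_at_most_one q) \<and> p = prod_list qs)"

definition det_polynomial :: "('n::finite \<Rightarrow> complex^'m^'m) \<Rightarrow> ('n, complex) multipoly"
  where "det_polynomial A =
    det (linear_pencil poly_var (\<lambda>k. \<chi> i j. poly_const (A k $ i $ j)))"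

end

theory Submission
  imports Defs "HOL-Complex_Analysis.Complex_Analysis" "HOL-Computational_Algebra.Fundamental_Theorem_Algebra"
begin

unbundle no fps_syntax

text \<open>
  The three conditions are proved equivalent along the cycle
  (a) \<open>\<Longrightarrow>\<close> (c) \<open>\<Longrightarrow>\<close> (b) \<open>\<Longrightarrow>\<close> (a).

  For (a) \<open>\<Longrightarrow>\<close> (c), commuting normal matrices have a basis of common eigenvectors
  (\<open>simultaneous_diagonalization\<close>); conjugating the pencil by this basis, over the ring of
  polynomials, makes it diagonal with affine entries.  For (c) \<open>\<Longrightarrow>\<close> (b), the joint spectrum is the
  zero set of the determinant, hence the union of the zero sets of the affine factors.  No factor
  vanishes at the origin, because the pencil is the identity there, so every zero set is a hyperplane
  or empty.

  The substance is (b) \<open>\<Longrightarrow>\<close> (a).  Restricting to two coordinates reduces it to a pair of normal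
  matrices \<open>A\<close>, \<open>B\<close> such that the zeros of \<open>f(z,w) = det (I + z A + w B)\<close> lie on finitely many lines
  that miss the origin (\<open>commute_if_spectrum_in_lines\<close>).  As \<open>A\<close> is normal, it has an eigenvalue \<open>a\<close>
  with \<open>|a| = \<parallel>A\<parallel>\<close>.  If \<open>A \<noteq> 0\<close>, then \<open>a \<noteq> 0\<close> and \<open>f(-1/a, 0) = 0\<close>.  By Hurwitz's theorem, zeros with
  \<open>w \<noteq> 0\<close> accumulate at this zero, so infinitely many zeros near it lie on a single line through
  \<open>(-1/a, 0)\<close>, and by analytic continuation \<open>f\<close> vanishes on all of that line: for some \<open>\<beta>\<close>, the number
  \<open>a x + \<beta>\<close> is an eigenvalue of \<open>x A + B\<close> for every \<open>x\<close> with \<open>a x + \<beta> \<noteq> 0\<close>.  Let \<open>x \<rightarrow> 0\<close>; a limit \<open>v\<close> of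
  unit eigenvectors satisfies \<open>B v = \<beta> v\<close>, and first-order perturbation gives \<open>\<langle>v, A v\<rangle> = a\<close>.  Since
  \<open>|a| = \<parallel>A\<parallel>\<close>, equality holds in the Cauchy-Schwarz inequality and \<open>A v = a v\<close>.  Thus \<open>v\<close> is a
  common eigenvector; replacing \<open>A\<close> and \<open>B\<close> by \<open>A - a v v*\<close> and \<open>B - \<beta> v v*\<close> subtracts the
  same matrix \<open>a \<beta> v v*\<close> from \<open>A B\<close> and from \<open>B A\<close>, keeps the hypotheses and enlarges the kernel of \<open>A\<close>,
  and an induction finishes the proof.
\<close>

section \<open>The Hermitian product and normal matrices\<close>

definition cdot :: "complex^'n \<Rightarrow> complex^'n \<Rightarrow> complex"
  where "cdot u v = (\<Sum>i\<in>UNIV. cnj (u $ i) * v $ i)"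

lemma cdot_simps [simp]:
  "cdot u 0 = 0" "cdot 0 u = 0"
  "cdot u (v + w) = cdot u v + cdot u w" "cdot (v + w) u = cdot v u + cdot w u"
  "cdot u (v - w) = cdot u v - cdot u w" "cdot (v - w) u = cdot v u - cdot w u"
  "cdot u (c *s v) = c * cdot u v" "cdot (c *s v) u = cnj c * cdot v u"
  by (simp_all add: cdot_def sum.distrib sum_subtractf sum_distrib_left algebra_simps)

lemma cnj_cdot: "cnj (cdot u v) = cdot v u"
  by (simp add: cdot_def mult.commute)

lemma cdot_self: "cdot v v = of_real ((norm v)\<^sup>2)"
proof -
  have "(norm v)\<^sup>2 = (\<Sum>i\<in>UNIV. (cmod (v $ i))\<^sup>2)"
    by (simp add: norm_vec_def L2_set_def sum_nonneg)
  moreover have "cdot v v = (\<Sum>i\<in>UNIV. of_real ((cmod (v $ i))\<^sup>2))"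
    unfolding cdot_def by (intro sum.cong refl) (metis complex_norm_square mult.commute)
  ultimately show ?thesis by simp
qed

lemma cdot_self_eq_0_iff [simp]: "cdot v v = 0 \<longleftrightarrow> v = 0"
  by (simp add: cdot_self)

lemma inner_eq_Re_cdot: "inner u v = Re (cdot u v)"
  by (simp add: inner_vec_def cdot_def inner_complex_def)

lemma cdot_adjoint: "cdot (conj_transpose A *v u) v = cdot u (A *v v)"
proof -
  have "cdot (conj_transpose A *v u) v = (\<Sum>i\<in>UNIV. \<Sum>j\<in>UNIV. A $ j $ i * cnj (u $ j) * v $ i)"
    by (simp add: cdot_def matrix_vector_mult_def conj_transpose_def sum_distrib_right)
  also have "\<dots> = (\<Sum>j\<in>UNIV. \<Sum>i\<in>UNIV. A $ j $ i * cnj (u $ j) * v $ i)"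
    by (rule sum.swap)
  also have "\<dots> = cdot u (A *v v)"
    by (simp add: cdot_def matrix_vector_mult_def sum_distrib_left algebra_simps)
  finally show ?thesis .
qed

lemma conj_transpose_conj_transpose [simp]: "conj_transpose (conj_transpose A) = A"
  by (simp add: conj_transpose_def vec_eq_iff)

lemma cdot_adjoint': "cdot u (conj_transpose A *v v) = cdot (A *v u) v"
  using cdot_adjoint[of "conj_transpose A" u v] by simp

lemma normal_adjoint_norm:
  assumes "normal_matrix A"
  shows "norm (conj_transpose A *v v) = norm (A *v v)"
proof -
  have "cdot (conj_transpose A *v v) (conj_transpose A *v v) = cdot v (A *v (conj_transpose A *v v))"
    by (rule cdot_adjoint)
  also have "\<dots> = cdot v (conj_transpose A *v (A *v v))"
    using assms by (simp add: matrix_vector_mul_assoc normal_matrix_def)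
  also have "\<dots> = cdot (A *v v) (A *v v)"
    by (rule cdot_adjoint')
  finally show ?thesis by (simp add: cdot_self power2_eq_iff_nonneg flip: of_real_power)
qed

text \<open>
  Expand \<open>\<parallel>A* v - cnj a v\<parallel>\<^sup>2\<close>: all the terms cancel because \<open>\<parallel>A* v\<parallel> = \<parallel>A v\<parallel>\<close>.
\<close>
lemma normal_eigenvector_adjoint:
  assumes "normal_matrix A" "A *v v = a *s v"
  shows "conj_transpose A *v v = cnj a *s v"
proof -
  let ?w = "conj_transpose A *v v"
  have n: "cdot ?w ?w = cdot (a *s v) (a *s v)"
    using normal_adjoint_norm[OF assms(1), of v] by (simp add: cdot_self assms(2) del: cdot_simps)
  have "cdot (?w - cnj a *s v) (?w - cnj a *s v) = 0"
    using n by (simp add: cdot_adjoint cdot_adjoint' assms(2) vec.scale algebra_simps)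
  then show ?thesis
    by (metis cdot_self_eq_0_iff right_minus_eq)
qed

section \<open>Eigenvectors in invariant subspaces\<close>

lemma span_initial_segment:
  fixes x :: "nat \<Rightarrow> complex^'n"
  assumes "y \<in> vec.span (x ` {..<k})"
  obtains c where "y = (\<Sum>i<k. c i *s x i)"
proof -
  let ?S = "range (\<lambda>c. \<Sum>i<k. c i *s x i)"
  have "vec.subspace ?S"
  proof (rule vec.subspaceI)
    show "0 \<in> ?S" by (rule range_eqI[of _ _ "\<lambda>_. 0"]) simp
    fix u v a assume "u \<in> ?S"
    then obtain c where c: "u = (\<Sum>i<k. c i *s x i)" by blast
    show "a *s u \<in> ?S"
      by (rule range_eqI[of _ _ "\<lambda>i. a * c i"]) (simp add: c vec.scale_sum_right)
    assume "v \<in> ?S"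
    then obtain d where d: "v = (\<Sum>i<k. d i *s x i)" by blast
    show "u + v \<in> ?S"
      by (rule range_eqI[of _ _ "\<lambda>i. c i + d i"]) (simp add: c d sum.distrib vec.scale_left_distrib)
  qed
  moreover have "x ` {..<k} \<subseteq> ?S"
  proof safe
    fix i assume "i < k"
    have "(\<Sum>j<k. (if j = i then 1 else 0) *s x j) = (\<Sum>j<k. if j = i then x j else 0)"
      by (intro sum.cong) auto
    also have "\<dots> = x i" using \<open>i < k\<close> by simp
    finally show "x i \<in> ?S"
      by (intro range_eqI[of _ _ "\<lambda>j. if j = i then 1 else 0"]) simp
  qed
  ultimately have "y \<in> ?S" using assms vec.span_minimal by blast
  then show thesis using that by blast
qed

text \<open>
  Otherwise the dimensions of the spans of the initial segments would grow without bound.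
\<close>
lemma exists_dependent_initial_segment:
  fixes x :: "nat \<Rightarrow> complex^'n"
  obtains k where "x k \<in> vec.span (x ` {..<k})"
proof (rule ccontr)
  assume "\<not> thesis"
  then have n: "x k \<notin> vec.span (x ` {..<k})" for k using that by blast
  have "vec.dim (x ` {..<k}) = k" for k
  proof (induction k)
    case (Suc k)
    then show ?case using n[of k] by (simp add: lessThan_Suc vec.dim_insert)
  qed simp
  then have "vec.dim (x ` {..<Suc CARD('n)}) = Suc CARD('n)" .
  moreover have "vec.dim (x ` {..<Suc CARD('n)}) \<le> CARD('n)"
    by (rule dim_subset_UNIV_cart_gen)
  ultimately show False by simp
qed

text \<open>
  The usual argument with a root \<open>a\<close> of an annihilating polynomial \<open>p = (X - a) q\<close>: either
  \<open>(A - a) v = 0\<close>, or \<open>q\<close> annihilates the nonzero vector \<open>(A - a) v\<close>, which is again in \<open>U\<close>. The bound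
  \<open>d\<close>, not the exact degree, is the induction variable, so that the sum has a fixed range.
\<close>
lemma annihilated_imp_eigenvector:
  fixes A :: "complex^'n^'n"
  assumes U: "vec.subspace U" "\<And>u. u \<in> U \<Longrightarrow> A *v u \<in> U"
    and "p \<noteq> 0" "degree p \<le> d" "v \<in> U" "v \<noteq> 0"
    and "(\<Sum>i\<le>d. coeff p i *s (((*v) A ^^ i) v)) = 0"
  shows "\<exists>u\<in>U. u \<noteq> 0 \<and> (\<exists>a. A *v u = a *s u)"
  using assms(3-)
proof (induction d arbitrary: p v)
  case 0
  then have "coeff p 0 \<noteq> 0" by (metis leading_coeff_0_iff le_zero_eq)
  with 0 show ?case by simp
next
  case (Suc d)
  show ?case
  proof (cases "degree p \<le> d")
    case True
    then have "coeff p (Suc d) = 0" by (simp add: coeff_eq_0)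
    then show ?thesis using Suc.IH[OF Suc.prems(1) True Suc.prems(3,4)] Suc.prems(5) by simp
  next
    case False
    then have deg: "degree p = Suc d" using Suc.prems by simp
    then have "\<not> constant (poly p)" by (simp add: Fundamental_Theorem_Algebra.constant_degree)
    then obtain a where "poly p a = 0" using Fundamental_Theorem_Algebra.fundamental_theorem_of_algebra by blast
    then obtain q where q: "p = [:- a, 1:] * q" by (metis poly_eq_0_iff_dvd dvdE)
    then have "q \<noteq> 0" using Suc.prems by auto
    then have dq: "degree q = d" using deg unfolding q by (subst (asm) degree_mult_eq) auto
    define w where "w = A *v v - a *s v"
    show ?thesis
    proof (cases "w = 0")
      case True
      then show ?thesis using Suc.prems w_def by auto
    next
      case False
      have w: "w \<in> U"
        unfolding w_def using Suc.prems U by (intro vec.subspace_diff vec.subspace_scale) auto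
      let ?y = "\<lambda>i. (((*v) A ^^ i) v)"
      have p: "coeff p i = (if i = 0 then 0 else coeff q (i - 1)) - a * coeff q i" for i
        unfolding q by (cases i) (simp_all add: mult_pCons_left)
      have yw: "((*v) A ^^ i) w = ?y (Suc i) - a *s ?y i" for i
      proof (induction i)
        case 0 then show ?case by (simp add: w_def)
      next
        case (Suc i) then show ?case
          by (simp add: vec.diff vec.scale)
      qed
      have "(\<Sum>i\<le>Suc d. coeff p i *s ?y i)
          = (\<Sum>i\<le>Suc d. (if i = 0 then 0 else coeff q (i - 1)) *s ?y i) - (\<Sum>i\<le>Suc d. (a * coeff q i) *s ?y i)"
        unfolding p by (simp only: vec.scale_left_diff_distrib sum_subtractf)
      also have "(\<Sum>i\<le>Suc d. (if i = 0 then 0 else coeff q (i - 1)) *s ?y i) = (\<Sum>i\<le>d. coeff q i *s ?y (Suc i))"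
        by (subst sum.atMost_Suc_shift) simp
      also have "(\<Sum>i\<le>Suc d. (a * coeff q i) *s ?y i) = (\<Sum>i\<le>d. (a * coeff q i) *s ?y i)"
        using dq by (simp add: coeff_eq_0)
      finally have "(\<Sum>i\<le>Suc d. coeff p i *s ?y i) = (\<Sum>i\<le>d. coeff q i *s ((*v) A ^^ i) w)"
        unfolding yw by (simp add: vec.scale_right_diff_distrib sum_subtractf mult.commute)
      then show ?thesis
        using Suc.IH[of q w] \<open>q \<noteq> 0\<close> dq w False Suc.prems(5) by simp
    qed
  qed
qed

lemma eigenvector_in_invariant_subspace:
  fixes A :: "complex^'n^'n"
  assumes "vec.subspace U" "\<And>u. u \<in> U \<Longrightarrow> A *v u \<in> U" "U \<noteq> {0}"
  obtains u a where "u \<in> U" "u \<noteq> 0" "A *v u = a *s u"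
proof -
  have "0 \<in> U" using assms(1) vec.subspace_0 by blast
  then obtain v where v: "v \<in> U" "v \<noteq> 0" using assms(3) by blast
  let ?y = "\<lambda>i. (((*v) A ^^ i) v)"
  obtain k where "?y k \<in> vec.span (?y ` {..<k})"
    by (rule exists_dependent_initial_segment)
  then obtain c where c: "?y k = (\<Sum>i<k. c i *s ?y i)"
    by (rule span_initial_segment)
  define p where "p = Poly (map (\<lambda>i. - c i) [0..<k] @ [1])"
  have co: "coeff p i = (if i < k then - c i else if i = k then 1 else 0)" for i
    unfolding p_def by (simp add: coeff_Poly_eq nth_default_def nth_append)
  have "p \<noteq> 0" using co[of k] by auto
  moreover have "degree p \<le> k" by (rule degree_le) (simp add: co)
  moreover have "(\<Sum>i\<le>k. coeff p i *s ?y i) = 0"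
  proof -
    have "(\<Sum>i\<le>k. coeff p i *s ?y i) = (\<Sum>i<k. - (c i *s ?y i)) + ?y k"
      by (simp add: lessThan_Suc_atMost[symmetric] co vec.scale_minus_left)
    then show ?thesis using c by (simp add: sum_negf)
  qed
  ultimately show thesis
    using annihilated_imp_eigenvector[OF assms(1,2) _ _ v] that by blast
qed

lemma tendsto_matrix_vector_mult:
  fixes A :: "complex^'n^'m"
  assumes "(u \<longlongrightarrow> v) F"
  shows "((\<lambda>n. A *v u n) \<longlongrightarrow> A *v v) F"
  unfolding matrix_vector_mult_def
  by (rule vec_tendstoI) (simp, intro tendsto_intros assms)

lemma norm_vector_smult: "norm (c *s v) = cmod c * norm (v :: complex^'n)"
proof -
  have "norm (c *s v) = sqrt (\<Sum>i\<in>UNIV. (cmod c)\<^sup>2 * (cmod (v $ i))\<^sup>2)"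
    by (simp add: norm_vec_def L2_set_def norm_mult power_mult_distrib)
  then show ?thesis
    by (simp add: norm_vec_def L2_set_def real_sqrt_mult flip: sum_distrib_left)
qed

text \<open>
  For a normal matrix the norm is the modulus of an eigenvalue. If a unit vector \<open>x\<close> maximizes
  \<open>\<parallel>A x\<parallel> = M\<close>, then \<open>A* A x = M\<^sup>2 x\<close>. The eigenspace of \<open>A* A\<close> for \<open>M\<^sup>2\<close> is invariant under \<open>A\<close> by
  normality, and every eigenvalue of \<open>A\<close> on it has modulus \<open>M\<close>.
\<close>
lemma normal_norm_attaining_eigenvalue:
  fixes A :: "complex^'n^'n"
  assumes nA: "normal_matrix A"
  obtains a u where "u \<noteq> 0" "A *v u = a *s u" "\<And>v. norm (A *v v) \<le> cmod a * norm v"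
proof -
  have cont: "continuous_on (sphere 0 1) (\<lambda>v. norm (A *v v))"
    unfolding continuous_on_def
    by (intro ballI tendsto_norm tendsto_matrix_vector_mult) (rule tendsto_ident_at)
  have ne: "sphere (0::complex^'n) 1 \<noteq> {}" by simp
  obtain x where x: "norm x = 1" and max: "\<And>v. norm v = 1 \<Longrightarrow> norm (A *v v) \<le> norm (A *v x)"
    using continuous_attains_sup[OF compact_sphere ne cont] by auto
  define M where "M = norm (A *v x)"
  have bound: "norm (A *v v) \<le> M * norm v" for v
  proof (cases "v = 0")
    case False
    let ?v = "of_real (1 / norm v) *s v"
    have "norm ?v = 1" using False by (simp add: norm_vector_smult norm_divide)
    then have "norm (A *v ?v) \<le> M" using max M_def by blast
    then have "norm (A *v v) / norm v \<le> M" by (simp add: vec.scale norm_vector_smult norm_divide)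
    then show ?thesis using False by (simp add: pos_divide_le_eq)
  qed simp
  define H where "H = conj_transpose A ** A"
  have H: "H *v v = conj_transpose A *v (A *v v)" for v
    by (simp add: H_def matrix_vector_mul_assoc)
  have HA: "H *v (A *v v) = A *v (H *v v)" for v
    using nA by (metis H matrix_vector_mul_assoc normal_matrix_def)
  have Hx: "H *v x = of_real (M\<^sup>2) *s x"
  proof -
    have "norm (H *v x) \<le> M * M"
      unfolding H normal_adjoint_norm[OF nA] using bound[of "A *v x"] M_def by simp
    then have 1: "(norm (H *v x))\<^sup>2 \<le> M^4"
      using power_mono[of "norm (H *v x)" "M * M" 2] by (simp add: power_mult_distrib eval_nat_numeral)
    have xH: "cdot x (H *v x) = of_real (M\<^sup>2)"
      by (simp add: H cdot_adjoint' cdot_self M_def)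
    then have Hx: "cdot (H *v x) x = of_real (M\<^sup>2)"
      by (metis cnj_cdot complex_cnj_complex_of_real)
    have "cdot (H *v x - of_real (M\<^sup>2) *s x) (H *v x - of_real (M\<^sup>2) *s x)
        = of_real ((norm (H *v x))\<^sup>2 - M^4)"
      by (simp add: xH Hx cdot_self[of x] cdot_self[of "H *v x"] x algebra_simps eval_nat_numeral)
    then have "(norm (H *v x - of_real (M\<^sup>2) *s x))\<^sup>2 \<le> 0"
      using 1 unfolding cdot_self of_real_eq_iff by simp
    then show ?thesis by simp
  qed
  define E where "E = {v. H *v v = of_real (M\<^sup>2) *s v}"
  have "vec.subspace E"
    unfolding E_def by (rule vec.subspaceI) (auto simp: vec.add vec.scale vec.scale_right_distrib mult.commute)
  moreover have "A *v v \<in> E" if "v \<in> E" for v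
    using that by (simp add: E_def HA vec.scale)
  moreover have "E \<noteq> {0}"
  proof -
    have "x \<in> E" "x \<noteq> 0" using Hx x by (auto simp: E_def)
    then show ?thesis by blast
  qed
  ultimately obtain u a where u: "u \<in> E" "u \<noteq> 0" "A *v u = a *s u"
    by (rule eigenvector_in_invariant_subspace)
  have "cdot (A *v u) (A *v u) = of_real (M\<^sup>2) * cdot u u"
    using u(1) by (simp add: E_def H flip: cdot_adjoint')
  then have "(cmod a * norm u)\<^sup>2 = (M * norm u)\<^sup>2"
    unfolding cdot_self u(3) norm_vector_smult
    by (metis of_real_eq_iff of_real_mult power_mult_distrib)
  then have "cmod a = M"
    using u(2) M_def by (simp add: power2_eq_iff_nonneg power_mult_distrib)
  with u bound that show thesis by blast
qed

section \<open>Pairs of normal matrices with spectrum in finitely many lines\<close>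

definition pair_pencil_det :: "complex^'n^'n \<Rightarrow> complex^'n^'n \<Rightarrow> complex \<Rightarrow> complex \<Rightarrow> complex"
  where "pair_pencil_det A B z w = det (\<chi> i j. mat 1 $ i $ j + z * A $ i $ j + w * B $ i $ j)"

lemma pair_pencil_det_eq_0_iff:
  fixes A B :: "complex^'n^'n"
  shows "pair_pencil_det A B z w = 0 \<longleftrightarrow> (\<exists>v. v \<noteq> 0 \<and> v + z *s (A *v v) + w *s (B *v v) = 0)"
proof -
  let ?M = "\<chi> i j. mat 1 $ i $ j + z * A $ i $ j + w * B $ i $ j"
  have "?M *v v = mat 1 *v v + z *s (A *v v) + w *s (B *v v)" for v
    by (simp add: vec_eq_iff matrix_vector_mult_def sum.distrib sum_distrib_left algebra_simps)
  then have "?M *v v = v + z *s (A *v v) + w *s (B *v v)" for v by simp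
  moreover have "det ?M = 0 \<longleftrightarrow> \<not> (\<exists>N. N ** ?M = mat 1)"
    using invertible_det_nz[of ?M] invertible_left_inverse[of ?M] by blast
  ultimately show ?thesis
    unfolding pair_pencil_det_def matrix_left_invertible_ker by auto
qed

lemma pair_pencil_det_holomorphic:
  assumes "f holomorphic_on S" "g holomorphic_on S"
  shows "(\<lambda>t. pair_pencil_det A B (f t) (g t)) holomorphic_on S"
  unfolding pair_pencil_det_def det_def vec_lambda_beta by (intro holomorphic_intros assms)

lemma pair_pencil_det_continuous: "continuous_on UNIV (\<lambda>p. pair_pencil_det A B (fst p) (snd p))"
  unfolding pair_pencil_det_def det_def vec_lambda_beta by (intro continuous_intros)

text \<open>
  A continuity-of-roots statement: if the functions \<open>z \<mapsto> f(z, w\<^sub>n)\<close> had no zeros near \<open>z0\<close> for a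
  sequence of nonzero \<open>w\<^sub>n \<rightarrow> 0\<close>, their limit would not vanish at \<open>z0\<close>, by Hurwitz's theorem. The
  finiteness hypothesis ensures that this limit is not constant.
\<close>
lemma pair_pencil_det_zeros_nearby:
  fixes A B :: "complex^'n^'n"
  assumes z0: "pair_pencil_det A B z0 0 = 0" and fin: "finite {z. pair_pencil_det A B z 0 = 0}" and "e > 0"
  shows "\<exists>z w. w \<noteq> 0 \<and> dist z z0 < e \<and> norm w < e \<and> pair_pencil_det A B z w = 0"
proof (rule ccontr)
  assume neg: "\<not> ?thesis"
  \<comment> \<open>Any null sequence of nonzero numbers in the ball of radius \<open>min e 1\<close> would do; the bound \<open>1\<close> keeps
      the \<open>w n\<close> in a fixed compact set for the uniform continuity below.\<close>
  define w :: "nat \<Rightarrow> complex" where "w n = of_real (min e 1 / (real n + 2))" for n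
  have m: "0 < min e 1" using \<open>e > 0\<close> by simp
  have w: "w n \<noteq> 0" "norm (w n) < e" "norm (w n) \<le> 1" for n
  proof -
    have "min e 1 / (real n + 2) \<le> min e 1 / 2" using m by (intro divide_left_mono) auto
    moreover have "0 < min e 1 / (real n + 2)" using m by simp
    then have "norm (w n) = min e 1 / (real n + 2)" unfolding w_def norm_of_real by linarith
    moreover have "min e 1 \<le> e" "min e 1 \<le> 1" by simp_all
    ultimately show "norm (w n) < e" "norm (w n) \<le> 1" using m by linarith+
    show "w n \<noteq> 0" using \<open>norm (w n) = _\<close> \<open>0 < min e 1 / _\<close> by auto
  qed
  have wl: "w \<longlonglongrightarrow> 0"
  proof -
    have "(\<lambda>n. min e 1 / (real n + 2)) \<longlonglongrightarrow> 0" by real_asymp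
    then have "(\<lambda>n. of_real (min e 1 / (real n + 2)) :: complex) \<longlonglongrightarrow> of_real 0" by (rule tendsto_of_real)
    then show ?thesis by (simp add: w_def[abs_def])
  qed
  have "pair_pencil_det A B z0 0 \<noteq> 0"
  proof (rule Hurwitz_no_zeros[of "ball z0 e" "\<lambda>n z. pair_pencil_det A B z (w n)" "\<lambda>z. pair_pencil_det A B z 0"])
    show "(\<lambda>z. pair_pencil_det A B z (w n)) holomorphic_on ball z0 e" for n
      by (intro pair_pencil_det_holomorphic holomorphic_intros)
    show "(\<lambda>z. pair_pencil_det A B z 0) holomorphic_on ball z0 e"
      by (intro pair_pencil_det_holomorphic holomorphic_intros)
    show "\<not> (\<lambda>z. pair_pencil_det A B z 0) constant_on ball z0 e"
    proof
      assume "(\<lambda>z. pair_pencil_det A B z 0) constant_on ball z0 e"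
      then have "ball z0 e \<subseteq> {z. pair_pencil_det A B z 0 = 0}"
      proof -
        obtain y where y: "\<And>z. z \<in> ball z0 e \<Longrightarrow> pair_pencil_det A B z 0 = y"
          using \<open>_ constant_on _\<close> unfolding constant_on_def by blast
        moreover have "y = 0" using y[of z0] z0 \<open>e > 0\<close> by simp
        ultimately show ?thesis by blast
      qed
      then have "finite (ball z0 e)" using fin finite_subset by blast
      then show False using \<open>e > 0\<close> uncountable_ball[of e z0] countable_finite by blast
    qed
    show "pair_pencil_det A B z (w n) \<noteq> 0" if "z \<in> ball z0 e" for n z
      using neg w[of n] that by (metis dist_commute mem_ball)
    show "uniform_limit K (\<lambda>n z. pair_pencil_det A B z (w n)) (\<lambda>z. pair_pencil_det A B z 0) sequentially"
      if "compact K" for K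
    proof (rule uniform_limitI)
      fix d :: real assume "d > 0"
      have "uniformly_continuous_on (K \<times> cball 0 1) (\<lambda>p. pair_pencil_det A B (fst p) (snd p))"
        using that by (intro compact_uniformly_continuous compact_Times compact_cball
            continuous_on_subset[OF pair_pencil_det_continuous]) auto
      then obtain r where r: "r > 0" "\<And>p q. p \<in> K \<times> cball 0 1 \<Longrightarrow> q \<in> K \<times> cball 0 1 \<Longrightarrow> dist p q < r
          \<Longrightarrow> dist (pair_pencil_det A B (fst p) (snd p)) (pair_pencil_det A B (fst q) (snd q)) < d"
        using \<open>d > 0\<close> unfolding uniformly_continuous_on_def by metis
      have "\<forall>\<^sub>F n in sequentially. dist (w n) 0 < r"
        using wl r(1) by (rule tendstoD)
      then show "\<forall>\<^sub>F n in sequentially. \<forall>z\<in>K. dist (pair_pencil_det A B z (w n)) (pair_pencil_det A B z 0) < d"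
      proof eventually_elim
        case (elim n)
        show ?case
        proof
          fix z assume "z \<in> K"
          have "dist (z, w n) (z, 0) < r" using elim by (simp add: dist_Pair_Pair)
          then show "dist (pair_pencil_det A B z (w n)) (pair_pencil_det A B z 0) < d"
            using r(2)[of "(z, w n)" "(z, 0)"] w(3)[of n] \<open>z \<in> K\<close> by simp
        qed
      qed
    qed
  qed (use \<open>e > 0\<close> in auto)
  with z0 show False by simp
qed

text \<open>
  Zeros with \<open>w \<noteq> 0\<close> accumulate at \<open>(-1/a, 0)\<close>, and infinitely many of them share a line
  \<open>1 + \<alpha> z + \<beta> w = 0\<close>. This line passes through the accumulation point, hence \<open>\<alpha> = a\<close>; the holomorphic
  restriction of the determinant to it has non-isolated zeros and so vanishes identically.
\<close>
lemma line_in_spectrum: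
  fixes A B :: "complex^'n^'n"
  assumes L: "finite L" "\<And>z w. pair_pencil_det A B z w = 0 \<Longrightarrow> \<exists>(\<alpha>, \<beta>)\<in>L. 1 + \<alpha> * z + \<beta> * w = 0"
    and a: "a \<noteq> 0" "pair_pencil_det A B (- 1 / a) 0 = 0"
  obtains \<beta> where "\<And>w. pair_pencil_det A B (- (1 + \<beta> * w) / a) w = 0"
proof -
  have "{z. pair_pencil_det A B z 0 = 0} \<subseteq> (\<lambda>(\<alpha>, \<beta>). - 1 / \<alpha>) ` L"
  proof
    fix z assume "z \<in> {z. pair_pencil_det A B z 0 = 0}"
    then obtain \<alpha> \<beta> where l: "(\<alpha>, \<beta>) \<in> L" "1 + \<alpha> * z = 0" using L(2)[of z 0] by auto
    then have "\<alpha> \<noteq> 0" "\<alpha> * z = - 1" by (auto simp: add_eq_0_iff)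
    then have "z = - 1 / \<alpha>" by (simp add: field_simps)
    with l(1) show "z \<in> (\<lambda>(\<alpha>, \<beta>). - 1 / \<alpha>) ` L" by force
  qed
  then have fin: "finite {z. pair_pencil_det A B z 0 = 0}" using L(1) finite_surj by blast
  have "\<exists>z w. w \<noteq> 0 \<and> dist z (- 1 / a) < 1 / real (Suc n) \<and> norm w < 1 / real (Suc n) \<and> pair_pencil_det A B z w = 0" for n
    by (rule pair_pencil_det_zeros_nearby[OF a(2) fin]) simp
  then obtain z w where zw: "\<And>n. w n \<noteq> 0" "\<And>n. dist (z n) (- 1 / a) < 1 / real (Suc n)"
      "\<And>n. norm (w n) < 1 / real (Suc n)" "\<And>n. pair_pencil_det A B (z n) (w n) = 0" by metis
  have lim0: "(\<lambda>n. 1 / real (Suc n)) \<longlonglongrightarrow> 0" by (rule LIMSEQ_Suc[OF lim_1_over_n])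
  have "(\<lambda>n. dist (z n) (- 1 / a)) \<longlonglongrightarrow> 0"
    by (rule tendsto_sandwich[OF _ _ tendsto_const lim0]) (intro always_eventually allI zero_le_dist less_imp_le[OF zw(2)])+
  then have z: "z \<longlonglongrightarrow> - 1 / a" by (rule tendsto_dist_iff[THEN iffD2])
  have "(\<lambda>n. norm (w n)) \<longlonglongrightarrow> 0"
    by (rule tendsto_sandwich[OF _ _ tendsto_const lim0]) (intro always_eventually allI norm_ge_zero less_imp_le[OF zw(3)])+
  then have w: "w \<longlonglongrightarrow> 0" by (simp add: tendsto_norm_zero_iff)
  have "\<exists>l\<in>L. 1 + fst l * z n + snd l * w n = 0" for n
    using L(2)[OF zw(4)[of n]] by force
  then obtain l where l: "\<And>n. l n \<in> L" "\<And>n. 1 + fst (l n) * z n + snd (l n) * w n = 0" by metis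
  have "finite (range l)" using L(1) l(1) finite_subset by (metis image_subsetI)
  then obtain m where inf: "infinite {n. l n = l m}"
    using pigeonhole_infinite[of "UNIV :: nat set" l] by auto
  obtain r :: "nat \<Rightarrow> nat" where r: "strict_mono r" "\<And>n. l (r n) = l m"
    using infinite_enumerate[OF inf] by auto
  define \<alpha> \<beta> where "\<alpha> = fst (l m)" and "\<beta> = snd (l m)"
  have eq: "1 + \<alpha> * z (r n) + \<beta> * w (r n) = 0" for n
    using l(2)[of "r n"] r(2)[of n] by (simp add: \<alpha>_def \<beta>_def)
  have zr: "(\<lambda>n. z (r n)) \<longlonglongrightarrow> - 1 / a" and wr: "(\<lambda>n. w (r n)) \<longlonglongrightarrow> 0"
    using LIMSEQ_subseq_LIMSEQ[OF z r(1)] LIMSEQ_subseq_LIMSEQ[OF w r(1)] by (simp_all add: o_def)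
  have "(\<lambda>n. 1 + \<alpha> * z (r n) + \<beta> * w (r n)) \<longlonglongrightarrow> 1 + \<alpha> * (- 1 / a) + \<beta> * 0"
    by (intro tendsto_intros zr wr)
  then have "1 + \<alpha> * (- 1 / a) + \<beta> * 0 = 0" using eq LIMSEQ_unique tendsto_const by fastforce
  then have "\<alpha> = a" using a(1) by (simp add: field_simps)
  have on_line: "z (r n) = - (1 + \<beta> * w (r n)) / a" for n
    using eq[of n] a(1) unfolding \<open>\<alpha> = a\<close> by (simp add: field_simps add_eq_0_iff)
  have "pair_pencil_det A B (- (1 + \<beta> * t) / a) t = 0" for t
  proof (rule analytic_continuation[of "\<lambda>t. pair_pencil_det A B (- (1 + \<beta> * t) / a) t" UNIV "range (\<lambda>n. w (r n))" 0])
    show "(\<lambda>t. pair_pencil_det A B (- (1 + \<beta> * t) / a) t) holomorphic_on UNIV"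
      using a(1) by (intro pair_pencil_det_holomorphic holomorphic_intros) auto
    show "0 islimpt range (\<lambda>n. w (r n))"
      unfolding islimpt_sequential
      by (intro exI[of _ "\<lambda>n. w (r n)"]) (use wr zw(1) in auto)
    show "pair_pencil_det A B (- (1 + \<beta> * s) / a) s = 0" if s: "s \<in> range (\<lambda>n. w (r n))" for s
    proof -
      obtain n where "s = w (r n)" using s by blast
      then show ?thesis using zw(4)[of "r n"] on_line[of n] by simp
    qed
  qed auto
  then show thesis by (rule that)
qed

text \<open>
  The equality case of the Cauchy-Schwarz inequality for \<open>v\<close> and \<open>A v\<close>.
\<close>
lemma norm_attaining_eigenvector:
  assumes "norm v = 1" "norm (A *v v) \<le> cmod a" "cdot v (A *v v) = a"
  shows "A *v v = a *s v"
proof -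
  have "cdot (A *v v) v = cnj a" by (metis assms(3) cnj_cdot)
  then have "cdot (A *v v - a *s v) (A *v v - a *s v) = of_real ((norm (A *v v))\<^sup>2) - cnj a * a"
    using assms(1,3) by (simp add: cdot_self[of v] cdot_self[of "A *v v"])
  also have "cnj a * a = of_real ((cmod a)\<^sup>2)" by (metis complex_norm_square mult.commute)
  finally have "(norm (A *v v - a *s v))\<^sup>2 = (norm (A *v v))\<^sup>2 - (cmod a)\<^sup>2"
    unfolding cdot_self by (metis of_real_diff of_real_eq_iff)
  moreover have "(norm (A *v v))\<^sup>2 \<le> (cmod a)\<^sup>2" using assms(2) by (simp add: power_mono)
  ultimately have "(norm (A *v v - a *s v))\<^sup>2 \<le> 0" by linarith
  then show ?thesis by simp
qed

text \<open>
  A first-order perturbation of \<open>B\<close> in the direction of \<open>A\<close>, along a line contained in the spectrum.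
  The extremal choice of the eigenvalue \<open>a\<close> of \<open>A\<close> turns the resulting compression identity
  \<open>\<langle>v, A v\<rangle> = a\<close> into \<open>A v = a v\<close>.
\<close>
lemma common_eigenvector_if_spectrum_in_lines:
  fixes A B :: "complex^'n^'n"
  assumes nA: "normal_matrix A" and nB: "normal_matrix B" and "A \<noteq> 0"
    and L: "finite L" "\<And>z w. pair_pencil_det A B z w = 0 \<Longrightarrow> \<exists>(\<alpha>, \<beta>)\<in>L. 1 + \<alpha> * z + \<beta> * w = 0"
  obtains v a b where "norm v = 1" "a \<noteq> 0" "A *v v = a *s v" "B *v v = b *s v"
proof -
  obtain a u0 where u0: "u0 \<noteq> 0" "A *v u0 = a *s u0" and bound: "\<And>v. norm (A *v v) \<le> cmod a * norm v"
    using normal_norm_attaining_eigenvalue[OF nA] by blast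
  have "a \<noteq> 0"
  proof
    assume "a = 0"
    then have "A *v v = 0 *v v" for v using bound[of v] by simp
    then show False using \<open>A \<noteq> 0\<close> matrix_eq by blast
  qed
  moreover have "pair_pencil_det A B (- 1 / a) 0 = 0"
    unfolding pair_pencil_det_eq_0_iff using u0 \<open>a \<noteq> 0\<close> by (intro exI[of _ u0]) simp
  ultimately obtain \<beta> where \<beta>: "\<And>w. pair_pencil_det A B (- (1 + \<beta> * w) / a) w = 0"
    using line_in_spectrum[OF L] by blast
  \<comment> \<open>A null sequence \<open>x n\<close> that avoids \<open>0\<close> and the exceptional value \<open>- \<beta> / a\<close>: for \<open>\<beta> \<noteq> 0\<close> the
      factor \<open>c\<close> makes \<open>a * x n\<close> a positive multiple of \<open>\<beta>\<close>.\<close>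
  define c where "c = (if \<beta> = 0 then 1 else \<beta> / a)"
  define x where "x n = c / of_nat (Suc n)" for n
  have c: "c \<noteq> 0" using \<open>a \<noteq> 0\<close> by (simp add: c_def)
  have x0: "x n \<noteq> 0" for n using c unfolding x_def by (simp del: of_nat_Suc)
  have \<mu>: "a * x n + \<beta> \<noteq> 0" for n
  proof (cases "\<beta> = 0")
    case True then show ?thesis using \<open>a \<noteq> 0\<close> x0 by simp
  next
    case False
    have "a * x n + \<beta> = \<beta> * (of_nat (n + 2) / of_nat (Suc n))"
      using False \<open>a \<noteq> 0\<close> unfolding x_def c_def by (simp add: divide_simps del: of_nat_Suc) (simp add: algebra_simps)
    also have "\<dots> \<noteq> 0" using False by (metis add_2_eq_Suc' divide_eq_0_iff mult_eq_0_iff of_nat_eq_0_iff nat.distinct(1))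
    finally show ?thesis .
  qed
  have xl: "x \<longlonglongrightarrow> 0"
    unfolding x_def by (rule LIMSEQ_Suc[OF lim_const_over_n])
  have "\<exists>u. norm u = 1 \<and> (a * x n + \<beta>) *s u = x n *s (A *v u) + B *v u" for n
  proof -
    let ?\<mu> = "a * x n + \<beta>"
    have "1 + \<beta> * (- 1 / ?\<mu>) = (?\<mu> - \<beta>) / ?\<mu>"
      using \<mu>[of n] by (simp only: diff_divide_distrib) simp
    then have "- (1 + \<beta> * (- 1 / ?\<mu>)) / a = - x n / ?\<mu>"
      using \<open>a \<noteq> 0\<close> by simp
    then have "pair_pencil_det A B (- x n / ?\<mu>) (- 1 / ?\<mu>) = 0" using \<beta>[of "- 1 / ?\<mu>"] by simp
    then obtain v where v: "v \<noteq> 0" "v + (- x n / ?\<mu>) *s (A *v v) + (- 1 / ?\<mu>) *s (B *v v) = 0"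
      unfolding pair_pencil_det_eq_0_iff by blast
    have "m *s v = y *s p + q" if "m \<noteq> 0" "v + (- y / m) *s p + (- 1 / m) *s q = 0" for m y and p q :: "complex^'n"
    proof -
      have "m *s (v + (- y / m) *s p + (- 1 / m) *s q) = 0" using that by simp
      then show ?thesis using that(1) by (simp add: vec.scale_right_distrib vec.scale_minus_left diff_eq_eq add.commute)
    qed
    from this[OF \<mu> v(2)] have e: "?\<mu> *s v = x n *s (A *v v) + B *v v" .
    let ?c = "of_real (1 / norm v) :: complex"
    have "norm (?c *s v) = 1" using v(1) by (simp add: norm_vector_smult norm_divide)
    moreover have "?\<mu> *s (?c *s v) = x n *s (A *v (?c *s v)) + B *v (?c *s v)"
    proof -
      have "?\<mu> *s (?c *s v) = ?c *s (?\<mu> *s v)" by (simp only: vector_smult_assoc mult.commute)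
      also have "\<dots> = ?c *s (x n *s (A *v v)) + ?c *s (B *v v)" unfolding e by (rule vec.scale_right_distrib)
      finally show ?thesis by (simp only: vec.scale vector_smult_assoc mult.commute)
    qed
    ultimately show ?thesis by blast
  qed
  then obtain u where u: "\<And>n. norm (u n) = 1" "\<And>n. (a * x n + \<beta>) *s u n = x n *s (A *v u n) + B *v u n"
    by metis
  have "\<exists>v\<in>sphere 0 1. \<exists>r. strict_mono (r :: nat \<Rightarrow> nat) \<and> (u \<circ> r) \<longlonglongrightarrow> v"
    using compact_sphere[of "0::complex^'n" 1] u(1) unfolding compact_def by auto
  then obtain v r where v: "norm v = 1" and r: "strict_mono (r :: nat \<Rightarrow> nat)" and ur: "(\<lambda>n. u (r n)) \<longlonglongrightarrow> v"
    by (auto simp: o_def)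
  have xr: "(\<lambda>n. x (r n)) \<longlonglongrightarrow> 0" using LIMSEQ_subseq_LIMSEQ[OF xl r] by (simp add: o_def)
  have scale: "((\<lambda>n. c n *s y n) \<longlonglongrightarrow> d *s (q :: complex^'n))" if "c \<longlonglongrightarrow> d" "y \<longlonglongrightarrow> q" for c d y q
    by (rule vec_tendstoI) (simp, intro tendsto_intros that)
  have B: "B *v v = \<beta> *s v"
  proof -
    have "(\<lambda>n. (a * x (r n) + \<beta>) *s u (r n)) \<longlonglongrightarrow> (a * 0 + \<beta>) *s v"
      by (intro scale tendsto_intros xr ur)
    moreover have "(\<lambda>n. x (r n) *s (A *v u (r n)) + B *v u (r n)) \<longlonglongrightarrow> 0 *s (A *v v) + B *v v"
      by (intro tendsto_add scale xr tendsto_matrix_vector_mult ur)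
    ultimately have "(a * 0 + \<beta>) *s v = 0 *s (A *v v) + B *v v"
      unfolding u(2) by (rule LIMSEQ_unique)
    then show ?thesis by simp
  qed
  \<comment> \<open>Pairing the eigenvalue equation with \<open>v\<close> removes \<open>B - \<beta>\<close>, as \<open>v\<close> is an eigenvector of the
      adjoint of \<open>B\<close>; what is left is divisible by \<open>x n\<close>.\<close>
  have compression: "cdot v (A *v u n) = a * cdot v (u n)" for n
  proof -
    have "cdot v (B *v u n) = cdot (conj_transpose B *v v) (u n)" by (rule cdot_adjoint[symmetric])
    also have "\<dots> = \<beta> * cdot v (u n)"
      using normal_eigenvector_adjoint[OF nB B] by simp
    finally have "x n * cdot v (A *v u n) + \<beta> * cdot v (u n) = cdot v ((a * x n + \<beta>) *s u n)"
      unfolding u(2) by simp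
    then have "x n * cdot v (A *v u n) = x n * (a * cdot v (u n))" by (simp add: algebra_simps)
    then show ?thesis using x0 by simp
  qed
  have lim: "(\<lambda>n. cdot v (y n)) \<longlonglongrightarrow> cdot v q" if "y \<longlonglongrightarrow> q" for y q
    unfolding cdot_def by (intro tendsto_intros that)
  have "(\<lambda>n. cdot v (A *v u (r n))) \<longlonglongrightarrow> cdot v (A *v v)"
    by (intro lim tendsto_matrix_vector_mult ur)
  moreover have "(\<lambda>n. a * cdot v (u (r n))) \<longlonglongrightarrow> a * cdot v v"
    by (intro tendsto_mult tendsto_const lim ur)
  ultimately have "cdot v (A *v v) = a * cdot v v"
    unfolding compression by (rule LIMSEQ_unique)
  then have "A *v v = a *s v"
    using bound[of v] v by (intro norm_attaining_eigenvector) (simp_all add: cdot_self)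
  with v \<open>a \<noteq> 0\<close> B that show thesis by blast
qed

text \<open>
  The rank-one modification \<open>A - a v v*\<close>. For a unit eigenvector \<open>v\<close> of a normal matrix \<open>A\<close> with
  eigenvalue \<open>a\<close> it vanishes on \<open>v\<close> and agrees with \<open>A\<close> on the orthogonal complement of \<open>v\<close>.
\<close>
definition deflate :: "complex^'n^'n \<Rightarrow> complex \<Rightarrow> complex^'n \<Rightarrow> complex^'n^'n"
  where "deflate A a v = (\<chi> i j. A $ i $ j - a * v $ i * cnj (v $ j))"

lemma deflate_mult_vec: "deflate A a v *v u = A *v u - (a * cdot v u) *s v"
  by (simp add: vec_eq_iff deflate_def matrix_vector_mult_def cdot_def sum_subtractf sum_distrib_left
      sum_distrib_right algebra_simps)

lemma conj_transpose_deflate: "conj_transpose (deflate A a v) = deflate (conj_transpose A) (cnj a) v"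
  by (simp add: vec_eq_iff deflate_def conj_transpose_def)

text \<open>
  Deflation is multiplicative when \<open>v\<close> is an eigenvector of the left factor and of the adjoint of
  the right one. For normal matrices these coincide, up to conjugation of the eigenvalue, so that
  normality and commutation both pass through deflation.
\<close>
lemma deflate_mult:
  assumes "norm v = 1" "A *v v = a *s v" "conj_transpose B *v v = cnj b *s v"
  shows "deflate A a v ** deflate B b v = deflate (A ** B) (a * b) v"
proof -
  have "cdot v v = 1" using assms(1) by (simp add: cdot_self)
  moreover have "cdot v (B *v u) = b * cdot v u" for u
    using assms(3) by (simp flip: cdot_adjoint)
  ultimately show ?thesis
    unfolding matrix_eq
    by (auto simp: matrix_vector_mul_assoc[symmetric] deflate_mult_vec vec.diff vec.scale assms(2) mult_ac)
qed

lemma deflate_inject: "deflate A a v = deflate B a v \<Longrightarrow> A = B"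
  by (simp add: deflate_def vec_eq_iff)

lemma normal_deflate:
  assumes "normal_matrix A" "norm v = 1" "A *v v = a *s v"
  shows "normal_matrix (deflate A a v)"
  using assms normal_eigenvector_adjoint[OF assms(1,3)]
  by (simp add: normal_matrix_def conj_transpose_deflate deflate_mult mult.commute)

text \<open>
  Induction on the codimension of the kernel of \<open>A\<close>, deflating by a common eigenvector. The
  hypothesis on the zeros survives: a kernel vector of the deflated pencil is orthogonal to \<open>v\<close>, where
  the deflated pencil and the original one agree.
\<close>
lemma commute_if_spectrum_in_lines:
  fixes A B :: "complex^'n^'n"
  assumes "normal_matrix A" "normal_matrix B"
    and "finite L" "\<And>z w. pair_pencil_det A B z w = 0 \<Longrightarrow> \<exists>(\<alpha>, \<beta>)\<in>L. 1 + \<alpha> * z + \<beta> * w = 0"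
  shows "A ** B = B ** A"
  using assms(1,2,4)
proof (induction "CARD('n) - vec.dim {u. A *v u = 0}" arbitrary: A B rule: less_induct)
  case less
  show ?case
  proof (cases "A = 0")
    case False
    obtain v a b where v: "norm v = 1" "a \<noteq> 0" "A *v v = a *s v" "B *v v = b *s v"
      using common_eigenvector_if_spectrum_in_lines[OF less.prems(1,2) False assms(3) less.prems(3)] by blast
    note adj = normal_eigenvector_adjoint[OF less.prems(1) v(3)] normal_eigenvector_adjoint[OF less.prems(2) v(4)]
    let ?A = "deflate A a v" and ?B = "deflate B b v"
    have vv: "cdot v v = 1" using v(1) by (simp add: cdot_self)
    have vA: "cdot v (A *v u) = a * cdot v u" and vB: "cdot v (B *v u) = b * cdot v u" for u
      using adj by (simp_all flip: cdot_adjoint)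
    have sub: "vec.subspace {u. M *v u = 0}" for M :: "complex^'n^'n"
      by (rule vec.subspaceI) (auto simp: vec.add vec.scale)
    have "{u. A *v u = 0} \<subset> {u. ?A *v u = 0}"
    proof
      show "{u. A *v u = 0} \<subseteq> {u. ?A *v u = 0}"
      proof clarify
        fix u assume "A *v u = 0"
        then have "a * cdot v u = 0" using vA[of u] by simp
        then show "?A *v u = 0" using \<open>A *v u = 0\<close> by (simp add: deflate_mult_vec)
      qed
      have "?A *v v = 0" "A *v v \<noteq> 0" using v vv by (auto simp: deflate_mult_vec)
      then show "{u. A *v u = 0} \<noteq> {u. ?A *v u = 0}" by blast
    qed
    then have "vec.dim {u. A *v u = 0} < vec.dim {u. ?A *v u = 0}"
      using sub by (intro vec.dim_psubset) (simp add: vec.span_eq_iff[THEN iffD2])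
    moreover have "vec.dim {u. ?A *v u = 0} \<le> CARD('n)"
      by (rule dim_subset_UNIV_cart_gen)
    ultimately have dim: "CARD('n) - vec.dim {u. ?A *v u = 0} < CARD('n) - vec.dim {u. A *v u = 0}" by linarith
    have lines: "\<exists>(\<alpha>, \<beta>)\<in>L. 1 + \<alpha> * z + \<beta> * w = 0" if zero: "pair_pencil_det ?A ?B z w = 0" for z w
    proof -
      obtain u where u: "u \<noteq> 0" "u + z *s (?A *v u) + w *s (?B *v u) = 0"
        using pair_pencil_det_eq_0_iff[THEN iffD1, OF zero] by blast
      \<comment> \<open>Both deflated matrices map into the orthogonal complement of \<open>v\<close>.\<close>
      have "cdot v (u + z *s (?A *v u) + w *s (?B *v u)) = cdot v u"
        by (simp add: deflate_mult_vec vv vA vB)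
      then have "cdot v u = 0" using u(2) by simp
      then have "u + z *s (A *v u) + w *s (B *v u) = 0" using u(2) by (simp add: deflate_mult_vec)
      with u(1) show ?thesis by (intro less.prems(3)) (auto simp: pair_pencil_det_eq_0_iff)
    qed
    have "?A ** ?B = ?B ** ?A"
      by (rule less.hyps[OF dim normal_deflate[OF less.prems(1) v(1,3)]
            normal_deflate[OF less.prems(2) v(1,4)] lines])
    then have "deflate (A ** B) (a * b) v = deflate (B ** A) (a * b) v"
      using v adj by (simp add: deflate_mult mult.commute)
    then show ?thesis by (rule deflate_inject)
  qed simp
qed

section \<open>Hyperplanes and affine functions\<close>

text \<open>
  If \<open>H = a + V\<close> misses the origin, then \<open>a \<notin> V\<close>, and some linear functional vanishes on \<open>V\<close> and
  equals \<open>-1\<close> at \<open>a\<close>.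
\<close>
lemma hyperplane_avoiding_0:
  fixes H :: "(complex^'n) set"
  assumes "complex_hyperplane H" "0 \<notin> H"
  shows "\<exists>l. \<forall>z\<in>H. 1 + (\<Sum>k\<in>UNIV. l k * z $ k) = 0"
proof -
  obtain a V where V: "vec.subspace V" and H: "H = (\<lambda>v. a + v) ` V"
    using assms(1) unfolding complex_hyperplane_def by blast
  have "a \<notin> V"
  proof
    assume "a \<in> V"
    then have "- a \<in> V" by (rule vec.subspace_neg[OF V])
    then have "a + - a \<in> H" unfolding H by (rule imageI)
    then show False using assms(2) by simp
  qed
  obtain B where B: "B \<subseteq> V" "vec.independent B" "V \<subseteq> vec.span B"
    by (rule vec.basis_exists[of V])
  have "vec.span B = V" using B(1,3) vec.span_minimal[OF B(1) V] by blast
  then have "vec.independent (insert a B)"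
    using \<open>a \<notin> V\<close> B(2) by (simp add: vec.independent_insert)
  then obtain g :: "complex^'n \<Rightarrow> complex^'n" where g: "Vector_Spaces.linear (*s) (*s) g"
    and gf: "\<forall>x\<in>insert a B. g x = (if x = a then - 1 else 0)"
    using vec.linear_independent_extend[of "insert a B" "\<lambda>x. if x = a then - 1 else 0"] by blast
  interpret g: Vector_Spaces.linear "(*s)" "(*s)" g by (rule g)
  have "g v = 0" if "v \<in> V" for v
  proof -
    have "v \<in> vec.span B" using that \<open>vec.span B = V\<close> by simp
    then show ?thesis
    proof (induction rule: vec.span_induct_alt)
      case (step c x y)
      then show ?case using gf \<open>a \<notin> V\<close> B(1) by (auto simp: g.add g.scale)
    qed (simp add: g.zero)
  qed
  then have gH: "g z = - 1" if "z \<in> H" for z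
    using that gf unfolding H by (auto simp: g.add)
  have expand: "g z = (\<Sum>k\<in>UNIV. z $ k *s g (axis k 1))" for z
  proof -
    have "g z = g (\<Sum>k\<in>UNIV. z $ k *s axis k 1)" by (simp add: basis_expansion)
    then show ?thesis by (simp add: g.sum g.scale)
  qed
  obtain i :: 'n where True by blast
  have "1 + (\<Sum>k\<in>UNIV. g (axis k 1) $ i * z $ k) = 0" if "z \<in> H" for z
  proof -
    have "(\<Sum>k\<in>UNIV. g (axis k 1) $ i * z $ k) = g z $ i"
      by (subst expand[of z]) (simp add: mult.commute)
    also have "\<dots> = - 1" using gH[OF that] by simp
    finally show ?thesis by simp
  qed
  then show ?thesis by (intro exI[of _ "\<lambda>k. g (axis k 1) $ i"]) blast
qed

lemma dim_eq_CARD_if_span: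
  fixes S :: "(complex^'n) set"
  assumes "vec.span S = UNIV"
  shows "vec.dim S = CARD('n)"
proof -
  have "vec.dim S = vec.dim (UNIV :: (complex^'n) set)"
    unfolding assms[symmetric] by (rule vec.dim_span[symmetric])
  then show ?thesis unfolding vec_dim_card .
qed

lemma complex_hyperplane_affine_zeros:
  fixes l :: "'n::finite \<Rightarrow> complex"
  assumes "l i \<noteq> 0"
  shows "complex_hyperplane {z. c + (\<Sum>k\<in>UNIV. l k * z $ k) = 0}"
proof -
  let ?l = "\<lambda>z :: complex^'n. \<Sum>k\<in>UNIV. l k * z $ k"
  let ?V = "{v. ?l v = 0}"
  have add: "?l (u + v) = ?l u + ?l v" and scale: "?l (d *s v) = d * ?l v" for u v d
    by (simp_all add: sum.distrib sum_distrib_left algebra_simps)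
  have axis: "?l (axis i d) = l i * d" for d
  proof -
    have "?l (axis i d) = (\<Sum>k\<in>UNIV. if k = i then l i * d else 0)"
      by (intro sum.cong) (auto simp: axis_def)
    then show ?thesis by simp
  qed
  have V: "vec.subspace ?V"
    by (rule vec.subspaceI) (simp_all add: add scale del: vector_add_component vector_smult_component)
  have "vec.span (insert (axis i 1) ?V) = UNIV"
  proof -
    have "z \<in> vec.span (insert (axis i 1) ?V)" for z
    proof -
      let ?c = "?l z / l i"
      have "?l (z + (- ?c) *s axis i 1) = 0"
        unfolding add scale axis using assms by simp
      then have "z + (- ?c) *s axis i 1 \<in> vec.span (insert (axis i 1) ?V)"
        by (intro vec.span_base) simp
      moreover have "?c *s axis i 1 \<in> vec.span (insert (axis i 1) ?V)"
        by (intro vec.span_scale vec.span_base) simp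
      ultimately have "(z + (- ?c) *s axis i 1) + ?c *s axis i 1 \<in> vec.span (insert (axis i 1) ?V)"
        by (rule vec.span_add)
      then show ?thesis by (simp add: vec.scale_minus_left del: vector_smult_assoc)
    qed
    then show ?thesis by blast
  qed
  then have "vec.dim (insert (axis i 1) ?V) = CARD('n)"
    by (rule dim_eq_CARD_if_span)
  moreover have "axis i 1 \<notin> vec.span ?V"
    unfolding vec.span_eq_iff[THEN iffD2, OF V] using axis[of 1] assms by simp
  ultimately have "vec.dim ?V + 1 = CARD('n)" by (simp add: vec.dim_insert)
  moreover have "{z. c + ?l z = 0} = (\<lambda>v. axis i (- c / l i) + v) ` ?V"
  proof (intro equalityI subsetI)
    fix z assume "z \<in> {z. c + ?l z = 0}"
    then have "?l (z + (- 1) *s axis i (- c / l i)) = 0"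
      unfolding add scale axis using assms by (simp add: add.commute)
    then show "z \<in> (\<lambda>v. axis i (- c / l i) + v) ` ?V"
      by (intro image_eqI[of _ _ "z + (- 1) *s axis i (- c / l i)"]) simp_all
  next
    fix z assume "z \<in> (\<lambda>v. axis i (- c / l i) + v) ` ?V"
    then obtain v where v: "z = axis i (- c / l i) + v" "?l v = 0" by blast
    have "?l z = - c" unfolding v(1) add axis v(2) using assms by simp
    then show "z \<in> {z. c + ?l z = 0}" by simp
  qed
  ultimately show ?thesis using V unfolding complex_hyperplane_def by blast
qed

section \<open>The joint point spectrum\<close>

lemma linear_pencil_mult_vec:
  "linear_pencil z A *v v = v + (\<Sum>k\<in>UNIV. z k *s (A k *v v))"
proof -
  have "(linear_pencil z A *v v) $ i = (v + (\<Sum>k\<in>UNIV. z k *s (A k *v v))) $ i" for i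
  proof -
    have "(linear_pencil z A *v v) $ i
        = (\<Sum>j\<in>UNIV. mat 1 $ i $ j * v $ j) + (\<Sum>j\<in>UNIV. \<Sum>k\<in>UNIV. z k * (A k $ i $ j * v $ j))"
      by (simp add: linear_pencil_def matrix_vector_mult_def sum.distrib sum_distrib_right distrib_right mult.assoc)
    also have "(\<Sum>j\<in>UNIV. mat 1 $ i $ j * v $ j) = (mat 1 *v v) $ i"
      by (simp add: matrix_vector_mult_def)
    also have "(\<Sum>j\<in>UNIV. \<Sum>k\<in>UNIV. z k * (A k $ i $ j * v $ j)) = (\<Sum>k\<in>UNIV. z k *s (A k *v v)) $ i"
      by (subst sum.swap) (simp add: matrix_vector_mult_def sum_distrib_left)
    finally show ?thesis by simp
  qed
  then show ?thesis by (simp add: vec_eq_iff)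
qed

lemma joint_point_spectrum_iff:
  "z \<in> joint_point_spectrum A \<longleftrightarrow> (\<exists>v. v \<noteq> 0 \<and> v + (\<Sum>k\<in>UNIV. z $ k *s (A k *v v)) = 0)"
proof -
  have "0 \<in> {v. linear_pencil (\<lambda>k. z $ k) A *v v = 0}" by simp
  then show ?thesis
    unfolding joint_point_spectrum_def linear_pencil_mult_vec by blast
qed

lemma joint_point_spectrum_det:
  "z \<in> joint_point_spectrum A \<longleftrightarrow> det (linear_pencil (\<lambda>k. z $ k) A) = 0"
proof -
  let ?M = "linear_pencil (\<lambda>k. z $ k) A"
  have "det ?M = 0 \<longleftrightarrow> \<not> (\<exists>N. N ** ?M = mat 1)"
    using invertible_det_nz[of ?M] invertible_left_inverse[of ?M] by blast
  then show ?thesis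
    unfolding joint_point_spectrum_iff matrix_left_invertible_ker linear_pencil_mult_vec by blast
qed

section \<open>Simultaneous diagonalization of commuting normal matrices\<close>

text \<open>
  Induction on the dimension: if some \<open>A k\<close> is not a scalar on \<open>U\<close>, one of its eigenspaces in \<open>U\<close> is
  a smaller nonzero subspace, and it is invariant because the matrices commute.
\<close>
lemma commuting_imp_common_eigenvector:
  fixes A :: "'k \<Rightarrow> complex^'n^'n"
  assumes comm: "\<And>i j. A i ** A j = A j ** A i"
    and "vec.subspace U" "\<And>k u. u \<in> U \<Longrightarrow> A k *v u \<in> U" "U \<noteq> {0}"
  shows "\<exists>u\<in>U. u \<noteq> 0 \<and> (\<forall>k. \<exists>a. A k *v u = a *s u)"
  using assms(2-)
proof (induction "vec.dim U" arbitrary: U rule: less_induct)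
  case less
  show ?case
  proof (cases "\<forall>k. \<exists>a. \<forall>u\<in>U. A k *v u = a *s u")
    case True
    moreover obtain u where "u \<in> U" "u \<noteq> 0" using less.prems(1,3) vec.subspace_0 by blast
    ultimately show ?thesis by blast
  next
    case False
    then obtain k where k: "\<And>a. \<exists>u\<in>U. A k *v u \<noteq> a *s u" by blast
    obtain v a where v: "v \<in> U" "v \<noteq> 0" "A k *v v = a *s v"
      using eigenvector_in_invariant_subspace[OF less.prems(1) less.prems(2)[of _ k] less.prems(3)] by blast
    let ?W = "{u\<in>U. A k *v u = a *s u}"
    have W: "vec.subspace ?W"
      using less.prems(1)
      by (intro vec.subspaceI)
        (auto simp: vec.subspace_0 vec.subspace_add vec.subspace_scale vec.add vec.scale
          vec.scale_right_distrib mult.commute)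
    have "vec.dim ?W < vec.dim U"
    proof (rule ccontr)
      assume "\<not> vec.dim ?W < vec.dim U"
      then have "?W = U" by (intro vec.subspace_dim_equal W less.prems(1)) auto
      then show False using k[of a] by blast
    qed
    moreover have "A j *v u \<in> ?W" if "u \<in> ?W" for j u
    proof -
      have "A k *v (A j *v u) = A j *v (A k *v u)" using comm by (metis matrix_vector_mul_assoc)
      then show ?thesis using that less.prems(2) by (auto simp: vec.scale)
    qed
    moreover have "?W \<noteq> {0}" using v by blast
    ultimately have "\<exists>u\<in>?W. u \<noteq> 0 \<and> (\<forall>k. \<exists>a. A k *v u = a *s u)"
      by (intro less.hyps W)
    then show ?thesis by blast
  qed
qed

text \<open>
  Real orthogonality to \<open>e\<close> and to \<open>\<i> e\<close> is complex orthogonality to \<open>e\<close>. Therefore the real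
  orthogonal complement serves.
\<close>
lemma exists_nonzero_orthogonal:
  fixes E :: "(complex^'n) set"
  assumes "vec.span E \<noteq> UNIV" and scale: "\<And>c e. e \<in> E \<Longrightarrow> c *s e \<in> E"
  obtains w where "w \<noteq> 0" "\<And>e. e \<in> E \<Longrightarrow> cdot e w = 0"
proof -
  have "r *\<^sub>R x = of_real r *s x" for r and x :: "complex^'n"
    by (simp add: vec_eq_iff scaleR_conv_of_real[where 'a = complex])
  then have "subspace (vec.span E)"
    by (auto simp: subspace_def vec.span_zero intro: vec.span_add vec.span_scale)
  then have "span E \<subseteq> vec.span E" by (intro span_minimal vec.span_superset)
  then have "span E \<noteq> UNIV" using assms(1) by blast
  then obtain w where w: "w \<noteq> 0" "\<forall>x\<in>span E. w \<bullet> x = 0"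
    using span_not_UNIV_orthogonal by blast
  have "cdot e w = 0" if "e \<in> E" for e
  proof -
    have re: "Re (cdot w x) = 0" if "x \<in> E" for x
      using w(2) span_base[OF that] by (simp add: inner_eq_Re_cdot)
    have "cdot w e = 0"
      using re[OF that] re[OF scale[OF that, of \<i>]] by (simp add: complex_eq_iff)
    then show ?thesis by (metis cnj_cdot complex_cnj_zero)
  qed
  with w(1) that show thesis by blast
qed

text \<open>
  The orthogonal complement of the common eigenvectors is invariant, as they are eigenvectors of
  the adjoints too. If it were nonzero, it would contain a common eigenvector, orthogonal to itself.
\<close>
lemma common_eigenvectors_span:
  fixes A :: "'k \<Rightarrow> complex^'n^'n"
  assumes comm: "\<And>i j. A i ** A j = A j ** A i" and normal: "\<And>i. normal_matrix (A i)"
  shows "vec.span {v. \<forall>k. \<exists>a. A k *v v = a *s v} = UNIV"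
proof (rule ccontr)
  define E where "E = {v. \<forall>k. \<exists>a. A k *v v = a *s v}"
  assume "vec.span {v. \<forall>k. \<exists>a. A k *v v = a *s v} \<noteq> UNIV"
  moreover have "c *s e \<in> E" if e: "e \<in> E" for c e
  proof -
    have "\<exists>a. A k *v (c *s e) = a *s (c *s e)" for k
    proof -
      obtain a where "A k *v e = a *s e" using e unfolding E_def by blast
      then show ?thesis by (intro exI[of _ a]) (simp add: vec.scale mult.commute)
    qed
    then show ?thesis by (simp add: E_def)
  qed
  ultimately obtain w where w: "w \<noteq> 0" "\<And>e. e \<in> E \<Longrightarrow> cdot e w = 0"
    using exists_nonzero_orthogonal[of E] unfolding E_def by blast
  let ?U = "{u. \<forall>e\<in>E. cdot e u = 0}"
  have "vec.subspace ?U" by (rule vec.subspaceI) auto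
  moreover have "A k *v u \<in> ?U" if u: "u \<in> ?U" for k u
  proof -
    have "cdot e (A k *v u) = 0" if e: "e \<in> E" for e
    proof -
      obtain a where "A k *v e = a *s e" using e unfolding E_def by blast
      then have "conj_transpose (A k) *v e = cnj a *s e" by (rule normal_eigenvector_adjoint[OF normal])
      then have "cdot e (A k *v u) = a * cdot e u" by (simp flip: cdot_adjoint)
      then show ?thesis using u e by simp
    qed
    then show ?thesis by simp
  qed
  moreover have "?U \<noteq> {0}" using w by blast
  ultimately have "\<exists>u\<in>?U. u \<noteq> 0 \<and> (\<forall>k. \<exists>a. A k *v u = a *s u)"
    by (intro commuting_imp_common_eigenvector comm)
  then obtain u where "u \<in> ?U" "u \<noteq> 0" "\<forall>k. \<exists>a. A k *v u = a *s u" by blast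
  then have "u \<in> E" "cdot u u = 0" by (auto simp: E_def)
  then show False using \<open>u \<noteq> 0\<close> by simp
qed

lemma simultaneous_diagonalization:
  fixes A :: "'k \<Rightarrow> complex^'n^'n"
  assumes "\<And>i j. A i ** A j = A j ** A i" "\<And>i. normal_matrix (A i)"
  obtains Q R :: "complex^'n^'n" and D
  where "Q ** R = mat 1" "\<And>k. A k ** Q = (\<chi> i j. Q $ i $ j * D k j)"
proof -
  define E where "E = {v. \<forall>k. \<exists>a. A k *v v = a *s v}"
  have spanE: "vec.span E = UNIV"
    unfolding E_def by (rule common_eigenvectors_span[OF assms])
  obtain B where B: "B \<subseteq> E" "vec.independent B" "E \<subseteq> vec.span B" "card B = vec.dim E"
    by (rule vec.basis_exists[of E])
  have "vec.dim E = CARD('n)"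
    by (rule dim_eq_CARD_if_span[OF spanE])
  then have "finite B" "card B = CARD('n)"
    using B(4) by (simp_all add: vec.finiteI_independent[OF B(2)])
  then obtain b :: "'n \<Rightarrow> complex^'n" where b: "bij_betw b UNIV B"
    using finite_same_card_bij[of "UNIV :: 'n set" B] by auto
  define Q :: "complex^'n^'n" where "Q = (\<chi> i j. b j $ i)"
  have "column j Q = b j" for j by (simp add: column_def Q_def vec_eq_iff)
  then have "columns Q = B" using b by (auto simp: columns_def bij_betw_def)
  moreover have "vec.span B = UNIV"
    using B(3) spanE vec.span_minimal[OF B(3) vec.subspace_span] by auto
  ultimately obtain R where R: "Q ** R = mat 1"
    using matrix_right_invertible_span_columns[of Q] by blast
  have "\<exists>a. A k *v b j = a *s b j" for k j
  proof -
    have "b j \<in> E" using b B(1) by (auto simp: bij_betw_def)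
    then show ?thesis by (simp add: E_def)
  qed
  then obtain D where D: "\<And>k j. A k *v b j = D k j *s b j" by metis
  have "A k ** Q = (\<chi> i j. Q $ i $ j * D k j)" for k
  proof -
    have "(A k ** Q) $ i $ j = Q $ i $ j * D k j" for i j
    proof -
      have "(A k ** Q) $ i $ j = (A k *v b j) $ i"
        by (simp add: matrix_matrix_mult_def matrix_vector_mult_def Q_def)
      then show ?thesis by (simp add: D Q_def)
    qed
    then show ?thesis by (simp add: vec_eq_iff)
  qed
  with R that show thesis by blast
qed

section \<open>Factorization of the determinant polynomial\<close>

lemma poly_const_simps [simp]:
  "poly_const 0 = 0" "poly_const 1 = 1"
  "poly_const (a + b) = poly_const a + poly_const b"
  "poly_const (a * b) = poly_const a * poly_const b"
  by (simp_all add: poly_const_def single_add mult_single)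

lemma poly_const_sum:
  fixes f :: "'b \<Rightarrow> 'a::comm_ring_1"
  shows "poly_const (sum f S) = (\<Sum>x\<in>S. poly_const (f x))"
  by (induction S rule: infinite_finite_induct) simp_all

lemma degree_at_most_one_affine:
  fixes c :: "'n::finite \<Rightarrow> 'a::comm_ring_1"
  shows "degree_at_most_one (1 + (\<Sum>k\<in>UNIV. poly_var k * poly_const (c k)))"
proof -
  let ?q = "1 + (\<Sum>k\<in>UNIV. poly_var k * poly_const (c k))"
  have mono: "poly_var k * poly_const (c k) = Poly_Mapping.single (Poly_Mapping.single k 1) (c k)" for k
    by (simp add: poly_var_def poly_const_def mult_single)
  have "Poly_Mapping.keys ?q \<subseteq> insert 0 (range (\<lambda>k. Poly_Mapping.single k 1))"
  proof
    fix m assume "m \<in> Poly_Mapping.keys ?q"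
    then have nz: "Poly_Mapping.lookup ?q m \<noteq> 0" by (simp add: in_keys_iff)
    show "m \<in> insert 0 (range (\<lambda>k. Poly_Mapping.single k 1))"
    proof (rule ccontr)
      assume "m \<notin> insert 0 (range (\<lambda>k. Poly_Mapping.single k 1))"
      then have "m \<noteq> 0" "\<And>k. Poly_Mapping.single k 1 \<noteq> m" by auto
      then have "Poly_Mapping.lookup ?q m = 0"
        unfolding mono by (simp add: lookup_add lookup_sum lookup_one lookup_single when_def)
      with nz show False by blast
    qed
  qed
  then show ?thesis
    unfolding degree_at_most_one_def by (fastforce simp: lookup_single when_def)
qed

text \<open>
  The relation \<open>A k Q = Q D k\<close> lifts to the pencil over the polynomial ring, with \<open>Q\<close> read as a
  matrix of constants. The determinant of the lifted \<open>Q\<close> is a unit, with inverse the determinant of the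
  lifted \<open>R\<close>, and can be cancelled although the ring is not a field.
\<close>
lemma det_polynomial_factors:
  fixes A :: "'n::finite \<Rightarrow> complex^'m^'m" and D :: "'n \<Rightarrow> 'm \<Rightarrow> complex"
  assumes QR: "Q ** R = mat 1" and AQ: "\<And>k. A k ** Q = (\<chi> i j. Q $ i $ j * D k j)"
  shows "det_polynomial A = (\<Prod>j\<in>UNIV. 1 + (\<Sum>k\<in>UNIV. poly_var k * poly_const (D k j)))"
proof -
  define C :: "complex^'m^'m \<Rightarrow> ('n, complex) multipoly^'m^'m" where "C M = (\<chi> i j. poly_const (M $ i $ j))" for M
  define F :: "'m \<Rightarrow> ('n, complex) multipoly" where "F j = 1 + (\<Sum>k\<in>UNIV. poly_var k * poly_const (D k j))" for j
  let ?P = "linear_pencil poly_var (\<lambda>k. C (A k))"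
  let ?D = "\<chi> i j. if i = j then F j else 0"
  have C_mult: "C (M ** N) = C M ** C N" for M N
    by (simp add: C_def matrix_matrix_mult_def vec_eq_iff poly_const_sum)
  have C_1: "C (mat 1) = mat 1"
    by (simp add: C_def mat_def vec_eq_iff)
  have "?P ** C Q = C Q ** ?D"
  proof -
    have "(?P ** C Q) $ i $ j = (C Q ** ?D) $ i $ j" for i j
    proof -
      have entry: "C M $ i $ l = poly_const (M $ i $ l)" for M i l by (simp add: C_def)
      have "(?P ** C Q) $ i $ j = (\<Sum>l\<in>UNIV. mat 1 $ i $ l * C Q $ l $ j)
          + (\<Sum>l\<in>UNIV. \<Sum>k\<in>UNIV. poly_var k * (C (A k) $ i $ l * C Q $ l $ j))"
        by (simp add: linear_pencil_def matrix_matrix_mult_def sum.distrib sum_distrib_right distrib_right mult.assoc)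
      also have "(\<Sum>l\<in>UNIV. mat 1 $ i $ l * C Q $ l $ j) = (mat 1 ** C Q) $ i $ j"
        by (simp add: matrix_matrix_mult_def)
      also have "\<dots> = C Q $ i $ j" by simp
      also have "(\<Sum>l\<in>UNIV. \<Sum>k\<in>UNIV. poly_var k * (C (A k) $ i $ l * C Q $ l $ j))
          = (\<Sum>k\<in>UNIV. poly_var k * (C (A k) ** C Q) $ i $ j)"
        by (subst sum.swap) (simp add: matrix_matrix_mult_def sum_distrib_left)
      also have "\<dots> = (\<Sum>k\<in>UNIV. poly_var k * (C Q $ i $ j * poly_const (D k j)))"
        by (simp only: C_mult[symmetric] AQ) (simp add: entry)
      also have "C Q $ i $ j + \<dots> = C Q $ i $ j * F j"
        by (simp add: F_def sum_distrib_left algebra_simps)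
      also have "\<dots> = (\<Sum>l\<in>UNIV. if l = j then C Q $ i $ l * F j else 0)" by simp
      also have "\<dots> = (C Q ** ?D) $ i $ j"
        unfolding matrix_matrix_mult_def vec_lambda_beta by (intro sum.cong) auto
      finally show ?thesis .
    qed
    then show ?thesis by (simp add: vec_eq_iff)
  qed
  then have "det (?P ** C Q) = det (C Q ** ?D)" by (rule arg_cong)
  then have PQ: "det ?P * det (C Q) = det (C Q) * det ?D" by (simp only: det_mul)
  have "det (C Q) * det (C R) = det (C (Q ** R))" by (simp only: C_mult det_mul)
  then have unit: "det (C Q) * det (C R) = 1" by (simp add: QR C_1)
  have "det ?P = det ?P * det (C Q) * det (C R)" by (simp only: mult.assoc unit mult_1_right)
  also have "\<dots> = det ?D * (det (C Q) * det (C R))" unfolding PQ by (simp only: mult_ac)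
  also have "\<dots> = det ?D" by (simp only: unit mult_1_right)
  also have "det ?D = (\<Prod>j\<in>UNIV. ?D $ j $ j)" by (rule det_diagonal) simp
  finally show ?thesis by (simp add: det_polynomial_def C_def F_def)
qed

lemma commuting_imp_completely_reducible:
  fixes A :: "'n::finite \<Rightarrow> complex^'m^'m"
  assumes "\<And>i j. A i ** A j = A j ** A i" "\<And>i. normal_matrix (A i)"
  shows "completely_reducible (det_polynomial A)"
proof -
  obtain Q R :: "complex^'m^'m" and D where QR: "Q ** R = mat 1" and AQ: "\<And>k. A k ** Q = (\<chi> i j. Q $ i $ j * D k j)"
    using simultaneous_diagonalization[of A, OF assms] by blast
  obtain js :: "'m list" where js: "set js = UNIV" "distinct js"
    using finite_distinct_list[OF finite] by blast
  let ?F = "\<lambda>j. 1 + (\<Sum>k\<in>UNIV. poly_var k * poly_const (D k j))"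
  have "det_polynomial A = prod_list (map ?F js)"
    using det_polynomial_factors[of Q R A D, OF QR AQ] prod.distinct_set_conv_list[OF js(2), of ?F] js(1) by simp
  then show ?thesis
    unfolding completely_reducible_def
    by (intro exI[of _ "map ?F js"]) (auto simp: degree_at_most_one_affine)
qed

section \<open>Evaluation of polynomials\<close>

definition eval_mpoly :: "('n::finite \<Rightarrow> complex) \<Rightarrow> ('n, complex) multipoly \<Rightarrow> complex"
  where "eval_mpoly z p = (\<Sum>m\<in>Poly_Mapping.keys p.
    Poly_Mapping.lookup p m * (\<Prod>k\<in>UNIV. z k ^ Poly_Mapping.lookup m k))"

lemma eval_mpoly_superset:
  assumes "finite S" "Poly_Mapping.keys p \<subseteq> S"
  shows "eval_mpoly z p = (\<Sum>m\<in>S. Poly_Mapping.lookup p m * (\<Prod>k\<in>UNIV. z k ^ Poly_Mapping.lookup m k))"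
  unfolding eval_mpoly_def
  by (intro sum.mono_neutral_left assms) (auto simp: in_keys_iff)

lemma eval_mpoly_0 [simp]: "eval_mpoly z 0 = 0"
  by (simp add: eval_mpoly_def)

lemma eval_mpoly_add: "eval_mpoly z (p + q) = eval_mpoly z p + eval_mpoly z q"
proof -
  let ?S = "Poly_Mapping.keys p \<union> Poly_Mapping.keys q"
  have "eval_mpoly z r = (\<Sum>m\<in>?S. Poly_Mapping.lookup r m * (\<Prod>k\<in>UNIV. z k ^ Poly_Mapping.lookup m k))"
    if "Poly_Mapping.keys r \<subseteq> ?S" for r
    using that by (intro eval_mpoly_superset) auto
  then show ?thesis
    using keys_add[of p q] by (simp add: lookup_add sum.distrib distrib_right)
qed

lemma eval_mpoly_uminus: "eval_mpoly z (- p) = - eval_mpoly z p"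
  using eval_mpoly_add[of z p "- p"] by (simp add: eq_neg_iff_add_eq_0 add.commute)

lemma eval_mpoly_sum: "eval_mpoly z (sum f S) = (\<Sum>x\<in>S. eval_mpoly z (f x))"
  by (induction S rule: infinite_finite_induct) (simp_all add: eval_mpoly_add)

lemma eval_mpoly_single:
  "eval_mpoly z (Poly_Mapping.single m c) = c * (\<Prod>k\<in>UNIV. z k ^ Poly_Mapping.lookup m k)"
  by (subst eval_mpoly_superset[of "{m}"]) auto

lemma eval_mpoly_1 [simp]: "eval_mpoly z 1 = 1"
  unfolding single_one[symmetric] eval_mpoly_single by simp

lemma poly_mapping_eq_sum_singles: "p = (\<Sum>m\<in>Poly_Mapping.keys p. Poly_Mapping.single m (Poly_Mapping.lookup p m))"
proof (rule poly_mapping_eqI)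
  fix m
  have "(\<Sum>n\<in>Poly_Mapping.keys p. Poly_Mapping.lookup p n when n = m) = Poly_Mapping.lookup p m"
    by (cases "m \<in> Poly_Mapping.keys p") (auto simp: when_def in_keys_iff)
  then show "Poly_Mapping.lookup p m
      = Poly_Mapping.lookup (\<Sum>m\<in>Poly_Mapping.keys p. Poly_Mapping.single m (Poly_Mapping.lookup p m)) m"
    by (simp add: lookup_sum lookup_single)
qed

text \<open>
  By bilinearity it suffices to treat monomials.
\<close>
lemma eval_mpoly_mult: "eval_mpoly z (p * q) = eval_mpoly z p * eval_mpoly z q"
proof -
  have single: "eval_mpoly z (Poly_Mapping.single m c * Poly_Mapping.single n d)
      = eval_mpoly z (Poly_Mapping.single m c) * eval_mpoly z (Poly_Mapping.single n d)" for m n c d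
    by (simp add: mult_single eval_mpoly_single lookup_add power_add prod.distrib mult_ac)
  have single_left: "eval_mpoly z (Poly_Mapping.single m c * q)
      = eval_mpoly z (Poly_Mapping.single m c) * eval_mpoly z q" for m c
  proof -
    let ?q = "\<Sum>n\<in>Poly_Mapping.keys q. Poly_Mapping.single n (Poly_Mapping.lookup q n)"
    have "eval_mpoly z (Poly_Mapping.single m c * ?q) = eval_mpoly z (Poly_Mapping.single m c) * eval_mpoly z ?q"
      by (simp only: sum_distrib_left eval_mpoly_sum single)
    then show ?thesis by (simp only: poly_mapping_eq_sum_singles[of q, symmetric])
  qed
  let ?p = "\<Sum>m\<in>Poly_Mapping.keys p. Poly_Mapping.single m (Poly_Mapping.lookup p m)"
  have "eval_mpoly z (?p * q) = eval_mpoly z ?p * eval_mpoly z q"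
    by (simp only: sum_distrib_right eval_mpoly_sum single_left)
  then show ?thesis by (simp only: poly_mapping_eq_sum_singles[of p, symmetric])
qed

lemma eval_mpoly_prod: "eval_mpoly z (prod f S) = (\<Prod>x\<in>S. eval_mpoly z (f x))"
  by (induction S rule: infinite_finite_induct) (simp_all add: eval_mpoly_mult)

lemma eval_mpoly_prod_list: "eval_mpoly z (prod_list ps) = prod_list (map (eval_mpoly z) ps)"
  by (induction ps) (simp_all add: eval_mpoly_mult)

lemma eval_mpoly_const [simp]: "eval_mpoly z (poly_const c) = c"
  by (simp add: poly_const_def eval_mpoly_single)

lemma eval_mpoly_var [simp]: "eval_mpoly z (poly_var k) = z k"
proof -
  have "(\<Prod>j\<in>UNIV. z j ^ Poly_Mapping.lookup (Poly_Mapping.single k 1) j) = (\<Prod>j\<in>UNIV. if j = k then z k else 1)"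
    by (intro prod.cong) (auto simp: lookup_single when_def)
  then show ?thesis by (simp add: poly_var_def eval_mpoly_single)
qed

lemma eval_mpoly_det: "eval_mpoly z (det M) = det (\<chi> i j. eval_mpoly z (M $ i $ j))"
proof -
  have sgn: "eval_mpoly z (of_int (sign \<pi>)) = of_int (sign \<pi>)" for \<pi> :: "'b \<Rightarrow> 'b"
    by (simp add: sign_def eval_mpoly_uminus)
  show ?thesis
    by (simp add: det_def eval_mpoly_sum eval_mpoly_mult eval_mpoly_prod sgn)
qed

lemma eval_det_polynomial: "eval_mpoly z (det_polynomial A) = det (linear_pencil z A)"
proof -
  have "eval_mpoly z (linear_pencil poly_var (\<lambda>k. \<chi> i j. poly_const (A k $ i $ j)) $ i $ j)
      = linear_pencil z A $ i $ j" for i j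
    by (simp add: linear_pencil_def mat_def eval_mpoly_add eval_mpoly_sum eval_mpoly_mult)
  then show ?thesis by (simp add: det_polynomial_def eval_mpoly_det)
qed

text \<open>
  A monomial of total degree at most one is \<open>1\<close> or a single indeterminate.
\<close>
lemma eval_mpoly_degree_at_most_one:
  assumes "degree_at_most_one q"
  obtains c l where "\<And>z. eval_mpoly z q = c + (\<Sum>k\<in>UNIV. l k * z k)"
proof -
  have keys: "Poly_Mapping.keys q \<subseteq> insert 0 (range (\<lambda>k. Poly_Mapping.single k 1))"
  proof
    fix m assume "m \<in> Poly_Mapping.keys q"
    then have deg: "(\<Sum>k\<in>UNIV. Poly_Mapping.lookup m k) \<le> 1"
      using assms unfolding degree_at_most_one_def by blast
    show "m \<in> insert 0 (range (\<lambda>k. Poly_Mapping.single k 1))"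
    proof (cases "m = 0")
      case False
      then obtain k where k: "Poly_Mapping.lookup m k \<noteq> 0"
        by (metis lookup_zero poly_mapping_eqI)
      have "Poly_Mapping.lookup m k + (\<Sum>j\<in>UNIV - {k}. Poly_Mapping.lookup m j) \<le> 1"
        using deg by (subst (asm) sum.remove[of _ k]) auto
      then have "Poly_Mapping.lookup m k = 1" "(\<Sum>j\<in>UNIV - {k}. Poly_Mapping.lookup m j) = 0"
        using k by linarith+
      then have "m = Poly_Mapping.single k 1"
        by (intro poly_mapping_eqI) (auto simp: lookup_single when_def)
      then show ?thesis by blast
    qed simp
  qed
  have single_nz: "Poly_Mapping.single k (1 :: nat) \<noteq> 0" for k :: 'a
    by (metis lookup_single_eq lookup_zero one_neq_zero)
  have zero_notin: "0 \<notin> range (\<lambda>k :: 'a. Poly_Mapping.single k (1 :: nat))"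
  proof
    assume "0 \<in> range (\<lambda>k :: 'a. Poly_Mapping.single k (1 :: nat))"
    then obtain k :: 'a where "0 = Poly_Mapping.single k (1 :: nat)" by blast
    then show False using single_nz[of k] by metis
  qed
  have inj: "inj (\<lambda>k :: 'a. Poly_Mapping.single k (1 :: nat))"
  proof (rule injI)
    fix j k :: 'a assume "Poly_Mapping.single j (1 :: nat) = Poly_Mapping.single k 1"
    then have "Poly_Mapping.lookup (Poly_Mapping.single j (1 :: nat)) j = Poly_Mapping.lookup (Poly_Mapping.single k 1) j"
      by simp
    then show "j = k" by (simp add: lookup_single when_def split: if_splits)
  qed
  have var: "(\<Prod>j\<in>UNIV. z j ^ Poly_Mapping.lookup (Poly_Mapping.single k 1) j) = z k" for z :: "'a \<Rightarrow> complex" and k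
    using eval_mpoly_var[of z k] by (simp add: poly_var_def eval_mpoly_single)
  have "eval_mpoly z q = Poly_Mapping.lookup q 0
      + (\<Sum>k\<in>UNIV. Poly_Mapping.lookup q (Poly_Mapping.single k 1) * z k)" for z
  proof -
    have "eval_mpoly z q = (\<Sum>m\<in>insert 0 (range (\<lambda>k. Poly_Mapping.single k 1)).
        Poly_Mapping.lookup q m * (\<Prod>k\<in>UNIV. z k ^ Poly_Mapping.lookup m k))"
      by (intro eval_mpoly_superset keys) simp
    also have "\<dots> = Poly_Mapping.lookup q 0 + (\<Sum>m\<in>range (\<lambda>k. Poly_Mapping.single k 1).
        Poly_Mapping.lookup q m * (\<Prod>k\<in>UNIV. z k ^ Poly_Mapping.lookup m k))"
      by (subst sum.insert) (use zero_notin in simp_all)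
    also have "(\<Sum>m\<in>range (\<lambda>k. Poly_Mapping.single k 1).
        Poly_Mapping.lookup q m * (\<Prod>k\<in>UNIV. z k ^ Poly_Mapping.lookup m k))
        = (\<Sum>k\<in>UNIV. Poly_Mapping.lookup q (Poly_Mapping.single k 1) * z k)"
      by (subst sum.reindex[OF inj]) (simp only: o_def var)
    finally show ?thesis .
  qed
  then show thesis by (rule that)
qed

section \<open>The equivalence\<close>

text \<open>
  Each factor \<open>c + \<Sum>\<^sub>k l\<^sub>k z\<^sub>k\<close> has \<open>c \<noteq> 0\<close> because the origin is not in the spectrum. Its zero
  set is therefore a hyperplane, unless all \<open>l\<^sub>k\<close> vanish and it is empty.
\<close>
lemma completely_reducible_imp_hyperplanes:
  fixes A :: "'n::finite \<Rightarrow> complex^'m^'m"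
  assumes "completely_reducible (det_polynomial A)"
  shows "\<exists>\<H>. finite \<H> \<and> (\<forall>H\<in>\<H>. complex_hyperplane H) \<and> joint_point_spectrum A = \<Union>\<H>"
proof -
  obtain qs where qs: "\<And>q. q \<in> set qs \<Longrightarrow> degree_at_most_one q" "det_polynomial A = prod_list qs"
    using assms unfolding completely_reducible_def by blast
  have spectrum: "z \<in> joint_point_spectrum A \<longleftrightarrow> (\<exists>q\<in>set qs. eval_mpoly (\<lambda>k. z $ k) q = 0)" for z
  proof -
    have "det (linear_pencil (\<lambda>k. z $ k) A) = prod_list (map (eval_mpoly (\<lambda>k. z $ k)) qs)"
      by (simp add: eval_det_polynomial[symmetric] qs(2) eval_mpoly_prod_list)
    then show ?thesis
      unfolding joint_point_spectrum_det by (force simp: prod_list_zero_iff)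
  qed
  define Z where "Z q = {z :: complex^'n. eval_mpoly (\<lambda>k. z $ k) q = 0}" for q
  let ?\<H> = "Z ` {q \<in> set qs. Z q \<noteq> {}}"
  have "complex_hyperplane (Z q)" if q: "q \<in> set qs" "Z q \<noteq> {}" for q
  proof -
    obtain c and l :: "'n \<Rightarrow> complex" where cl: "\<And>z. eval_mpoly z q = c + (\<Sum>k\<in>UNIV. l k * z k)"
      using eval_mpoly_degree_at_most_one[OF qs(1)[OF q(1)]] by blast
    have Z: "Z q = {z. c + (\<Sum>k\<in>UNIV. l k * z $ k) = 0}" by (simp add: Z_def cl)
    have "(0 :: complex^'n) \<notin> joint_point_spectrum A"
      by (simp add: joint_point_spectrum_iff)
    then have "(0 :: complex^'n) \<notin> Z q" using q(1) spectrum unfolding Z_def by blast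
    then have "c \<noteq> 0" by (simp add: Z)
    then obtain i where "l i \<noteq> 0" using q(2) Z by fastforce
    then show ?thesis unfolding Z by (rule complex_hyperplane_affine_zeros)
  qed
  moreover have "joint_point_spectrum A = \<Union>?\<H>"
  proof -
    have "z \<in> joint_point_spectrum A \<longleftrightarrow> (\<exists>q\<in>set qs. z \<in> Z q)" for z
      using spectrum by (simp add: Z_def)
    then show ?thesis by blast
  qed
  ultimately show ?thesis by (intro exI[of _ ?\<H>]) auto
qed

text \<open>
  The points \<open>z e\<^sub>i + w e\<^sub>j\<close> of the joint spectrum form the spectrum of the pair \<open>A i\<close>, \<open>A j\<close>. Each
  hyperplane misses the origin, so it cuts this coordinate plane in a line that misses the origin or not
  at all.
\<close>
lemma hyperplanes_imp_commuting:
  fixes A :: "'n::finite \<Rightarrow> complex^'m^'m"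
  assumes normal: "\<And>i. normal_matrix (A i)"
    and \<H>: "finite \<H>" "\<And>H. H \<in> \<H> \<Longrightarrow> complex_hyperplane H" "joint_point_spectrum A = \<Union>\<H>"
  shows "A i ** A j = A j ** A i"
proof (cases "i = j")
  case False
  have "0 \<notin> joint_point_spectrum A" by (simp add: joint_point_spectrum_iff)
  then have "\<exists>l. \<forall>z\<in>H. 1 + (\<Sum>k\<in>UNIV. l k * z $ k) = 0" if "H \<in> \<H>" for H :: "(complex^'n) set"
    using that \<H>(2,3) by (intro hyperplane_avoiding_0) auto
  then obtain l where l: "\<And>H z. H \<in> \<H> \<Longrightarrow> z \<in> H \<Longrightarrow> 1 + (\<Sum>k\<in>UNIV. l H k * z $ k) = 0"
    by metis
  show ?thesis
  proof (rule commute_if_spectrum_in_lines[OF normal normal])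
    show "finite ((\<lambda>H. (l H i, l H j)) ` \<H>)" using \<H>(1) by simp
    fix z w assume "pair_pencil_det (A i) (A j) z w = 0"
    then obtain v where v: "v \<noteq> 0" "v + z *s (A i *v v) + w *s (A j *v v) = 0"
      unfolding pair_pencil_det_eq_0_iff by blast
    define Z :: "complex^'n" where "Z = (\<chi> k. if k = i then z else if k = j then w else 0)"
    have two: "(\<Sum>k\<in>UNIV. g k) = g i + g j" if "\<And>k. k \<noteq> i \<Longrightarrow> k \<noteq> j \<Longrightarrow> g k = 0"
      for g :: "'n \<Rightarrow> 'b::comm_monoid_add"
    proof -
      have "(\<Sum>k\<in>UNIV. g k) = (\<Sum>k\<in>{i, j}. g k)"
        by (rule sum.mono_neutral_right) (use that in auto)
      then show ?thesis using False by simp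
    qed
    have "(\<Sum>k\<in>UNIV. Z $ k *s (A k *v v)) = z *s (A i *v v) + w *s (A j *v v)"
      using False by (subst two) (auto simp: Z_def)
    then have "Z \<in> joint_point_spectrum A"
      unfolding joint_point_spectrum_iff using v by (intro exI[of _ v]) (simp add: add.assoc)
    then obtain H where H: "H \<in> \<H>" "Z \<in> H" using \<H>(3) by blast
    have "(\<Sum>k\<in>UNIV. l H k * Z $ k) = l H i * z + l H j * w"
      using False by (subst two) (auto simp: Z_def)
    then have "1 + l H i * z + l H j * w = 0" using l[OF H] by (simp add: add.assoc)
    then show "\<exists>(\<alpha>, \<beta>)\<in>(\<lambda>H. (l H i, l H j)) ` \<H>. 1 + \<alpha> * z + \<beta> * w = 0"
      using H(1) by force
  qed
qed simp

theorem theoremB: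
  fixes A :: "'n::finite \<Rightarrow> complex^'m^'m"
  assumes "\<And>i. normal_matrix (A i)"
    and "\<exists>i. A i \<noteq> 0"
  shows "((\<forall>i j. A i ** A j = A j ** A i) \<longleftrightarrow>
           (\<exists>\<H>. finite \<H> \<and> (\<forall>H\<in>\<H>. complex_hyperplane H) \<and>
              joint_point_spectrum A = \<Union>\<H>)) \<and>
         ((\<exists>\<H>. finite \<H> \<and> (\<forall>H\<in>\<H>. complex_hyperplane H) \<and>
              joint_point_spectrum A = \<Union>\<H>) \<longleftrightarrow>
           completely_reducible (det_polynomial A))"
  (is "(?a \<longleftrightarrow> ?b) \<and> (?b \<longleftrightarrow> ?c)")
proof -
  have "?c" if ?a
    using that assms(1) by (intro commuting_imp_completely_reducible) blast+
  moreover have "?b" if ?c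
    using that by (rule completely_reducible_imp_hyperplanes)
  moreover have "?a" if ?b
  proof -
    obtain \<H> where \<H>: "finite \<H>" "\<forall>H\<in>\<H>. complex_hyperplane H" "joint_point_spectrum A = \<Union>\<H>"
      using \<open>?b\<close> by blast
    have "A i ** A j = A j ** A i" for i j
      by (rule hyperplanes_imp_commuting[OF assms(1) \<H>(1) _ \<H>(3)]) (use \<H>(2) in blast)
    then show ?thesis by blast
  qed
  ultimately show ?thesis by blast
qed

end
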